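(* Let $\mu_-$, $\mu_0$, $\mu_+$ be finitely supported, non-degenerate, aperiodic probability measures on $\mathrm{DA}(\mathbb{T})$ satisfying $\mathbb{E}_{\check\mu_-}\Phi<0$, $\mathbb{E}_{\check\mu_0}\Phi=0$ and $\mathbb{E}_{\check\mu_+}\Phi>0$ respectively, and let $\nu_-$, $\nu_0$, $\nu_+$ be the corresponding harmonic measures on $\prod_{\mathbb{T}}\mathfrak{S}_q$. Then $\nu_-$, $\nu_0$ and $\nu_+$ are carried by pairwise disjoint measurable subsets of $\prod_{\mathbb{T}}\mathfrak{S}_q$. In particular, they are mutually singular.
   Context: Tree and groups. Fix an integer $q\ge 2$, let $\mathcal{A}_q=\{0,\dots,q-1\}$, and let the symmetric group $\mathfrak{S}_q$ act on $\mathcal{A}_q$ on the right, $t\mapsto t.\sigma$. For $m\in\mathbb{Z}$ let $H_m$ be the set of sequences $(u_k)_{k\le m}$ indexed by integers $k\le m$, with values in $\mathcal{A}_q$, and equal to $0$ for all sufficiently negative $k$. The $(q+1)$-regular tree $\mathbb{T}$ has vertex set $\bigsqcup_{m\in\mathbb{Z}}H_m$, each vertex of $H_m$ being joined by an edge to its ancestor in $H_{m-1}$ obtained by deleting the last entry; for a vertex $v$ and $t\in\mathcal{A}_q$, $vt$ is the child of $v$ obtained by appending $t$. Let $\omega(n)\in H_{-n}$ be the zero sequence, $o=\omega(0)$, and $\omega$ the end of $\mathbb{T}$ represented by the ray $(\omega(n))_{n\ge0}$. $\mathrm{Aff}(\mathbb{T})$ is the group of graph automorphisms of $\mathbb{T}$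 fixing $\omega$; it acts on the right ($v\mapsto v.g$; in $gh$, $g$ is applied first). Put $\beta(v)=m$ for $v\in H_m$ and let $\Phi:\mathrm{Aff}(\mathbb{T})\to\mathbb{Z}$ be the homomorphism $\Phi(g)=\beta(v.g)-\beta(v)$ (independent of $v$), with kernel $\mathrm{Hor}(\mathbb{T})$. Let $\alpha\in\mathrm{Aff}(\mathbb{T})$ be the shift $(u_k)_{k\le m}\mapsto(u_{k-1})_{k\le m+1}$, so $\Phi(\alpha)=1$. For $\gamma\in\mathrm{Hor}(\mathbb{T})$ the portrait of $\gamma$ is the function $v\mapsto\gamma[v]\in\mathfrak{S}_q$ determined by $(vt).\gamma=(v.\gamma)(t.\gamma[v])$ for all vertices $v$ and $t\in\mathcal{A}_q$. Every $g\in\mathrm{Aff}(\mathbb{T})$ is uniquely $g=\gamma\alpha^m$ with $\gamma\in\mathrm{Hor}(\mathbb{T})$, $m\in\mathbb{Z}$, and one sets $g[v]:=\gamma[v]$. The discrete affine group is $\mathrm{DA}(\mathbb{T})=\{g\in\mathrm{Aff}(\mathbb{T}): g[v]=e \text{ for all but finitely many } v\}$. Random walk. A probability measure $\mu$ on $\mathrm{DA}(\mathbb{T})$ is non-degenerate if its support generates $\mathrm{DA}(\mathbb{T})$ as a semigroup, and aperiodic if for any $g,g'\in\mathrm{DA}(\mathbb{T})$ there is $l\ge1$ such that the support of the $l$-fold convolution power of $\mu$ contains both $g$ and $g'$. $\check\mu(g)=\mu(g^{-1})$ and $\mathbb{E}_{\check\mu}\Phi=\sum_g\Phi(g)\check\mu(g)$.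 The right random walk is $w_n=x_1\cdots x_n$ with $x_i$ i.i.d. of law $\mu$ (started at $e$), and $\mathbb{P}$ denotes its law. For $\mu$ finitely supported and non-degenerate, almost surely for every vertex $v$ the sequence $(w_n[v])_n$ is eventually constant; its limit is $\gamma_\infty[v]$, which defines the random final configuration $\gamma_\infty\in\prod_{\mathbb{T}}\mathfrak{S}_q$. The harmonic measure of $\mu$ is the law $(\gamma_\infty)_*\mathbb{P}$ on $\prod_{\mathbb{T}}\mathfrak{S}_q$ (with the product $\sigma$-field). *)

theory Defs
  imports "HOL-Probability.Probability" "HOL-Algebra.Group" "HOL-Combinatorics.Permutations"
begin

section \<open>The tree\<close>

text \<open>
  A vertex is a pair \<open>(m, u)\<close> where \<open>u\<close> is a sequence indexed by the integers \<open>k \<le> m\<close>,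
  rendered as an extensional function on \<open>{..m}\<close>. The first component makes the union over \<open>m\<close>
  disjoint and is the value of \<open>\<beta>\<close>.
\<close>

type_synonym vertex = "int \<times> (int \<Rightarrow> nat)"

definition horosphere :: "nat \<Rightarrow> int \<Rightarrow> (int \<Rightarrow> nat) set" where
  "horosphere q m = {u \<in> {..m} \<rightarrow>\<^sub>E {..<q}. \<exists>N. \<forall>k\<le>m. k \<le> N \<longrightarrow> u k = 0}"

definition verts :: "nat \<Rightarrow> vertex set" where
  "verts q = Sigma UNIV (horosphere q)"

definition parent :: "vertex \<Rightarrow> vertex" where
  "parent v = (fst v - 1, restrict (snd v) {..fst v - 1})"

definition child :: "vertex \<Rightarrow> nat \<Rightarrow> vertex" where
  "child v t = (fst v + 1, (snd v)(fst v + 1 := t))"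

definition adjacent :: "nat \<Rightarrow> vertex \<Rightarrow> vertex \<Rightarrow> bool" where
  "adjacent q v w \<longleftrightarrow> v \<in> verts q \<and> w \<in> verts q \<and> (v = parent w \<or> w = parent v)"

definition height :: "vertex \<Rightarrow> int" where
  "height v = fst v"

definition omega :: "nat \<Rightarrow> vertex" where
  "omega n = (- int n, \<lambda>k\<in>{..- int n}. 0)"

text \<open>Two geodesic rays of a tree represent the same end iff they merge up to a time shift.\<close>

definition same_end :: "(nat \<Rightarrow> vertex) \<Rightarrow> (nat \<Rightarrow> vertex) \<Rightarrow> bool" where
  "same_end r s \<longleftrightarrow> (\<exists>a b. \<forall>n. r (a + n) = s (b + n))"


section \<open>The groups\<close>

text \<open>
  Permutations and automorphisms act on the right. A bijection of a set \<open>A\<close> is a HOL function that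
  \<open>permutes A\<close>, hence is the identity off \<open>A\<close>, so that equality of bijections is equality of
  functions. In the product of \<open>g\<close> and \<open>h\<close> the map \<open>g\<close> is applied first.
\<close>

definition Sym :: "nat \<Rightarrow> (nat \<Rightarrow> nat) set" where
  "Sym q = {\<sigma>. \<sigma> permutes {..<q}}"

definition graph_automorphism :: "nat \<Rightarrow> (vertex \<Rightarrow> vertex) \<Rightarrow> bool" where
  "graph_automorphism q g \<longleftrightarrow> g permutes verts q \<and>
     (\<forall>v\<in>verts q. \<forall>w\<in>verts q. adjacent q (g v) (g w) \<longleftrightarrow> adjacent q v w)"

definition Aff :: "nat \<Rightarrow> (vertex \<Rightarrow> vertex) monoid" where
  "Aff q = \<lparr>carrier = {g. graph_automorphism q g \<and> same_end (g \<circ> omega) omega},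
            mult = (\<lambda>g h. h \<circ> g), one = id\<rparr>"

text \<open>
  On \<open>Aff q\<close> the difference \<open>height (g v) - height v\<close> does not depend on the vertex \<open>v\<close>;
  it is evaluated at \<open>o = omega 0\<close>.
\<close>

definition Phi :: "(vertex \<Rightarrow> vertex) \<Rightarrow> int" where
  "Phi g = height (g (omega 0)) - height (omega 0)"

definition Hor :: "nat \<Rightarrow> (vertex \<Rightarrow> vertex) set" where
  "Hor q = {g \<in> carrier (Aff q). Phi g = 0}"

definition tree_shift :: "nat \<Rightarrow> vertex \<Rightarrow> vertex" where
  "tree_shift q v = (if v \<in> verts q then (fst v + 1, \<lambda>k\<in>{..fst v + 1}. snd v (k - 1)) else v)"

definition hor_portrait :: "nat \<Rightarrow> (vertex \<Rightarrow> vertex) \<Rightarrow> vertex \<Rightarrow> nat \<Rightarrow> nat" where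
  "hor_portrait q \<gamma> v = (THE \<sigma>. \<sigma> \<in> Sym q \<and> (\<forall>t<q. \<gamma> (child v t) = child (\<gamma> v) (\<sigma> t)))"

definition hor_part :: "nat \<Rightarrow> (vertex \<Rightarrow> vertex) \<Rightarrow> vertex \<Rightarrow> vertex" where
  "hor_part q g =
     (THE \<gamma>. \<gamma> \<in> Hor q \<and> (\<exists>m::int. g = \<gamma> \<otimes>\<^bsub>Aff q\<^esub> (tree_shift q [^]\<^bsub>Aff q\<^esub> m)))"

definition portrait :: "nat \<Rightarrow> (vertex \<Rightarrow> vertex) \<Rightarrow> vertex \<Rightarrow> nat \<Rightarrow> nat" where
  "portrait q g = hor_portrait q (hor_part q g)"

definition DA :: "nat \<Rightarrow> (vertex \<Rightarrow> vertex) set" where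
  "DA q = {g \<in> carrier (Aff q). finite {v \<in> verts q. portrait q g v \<noteq> id}}"


section \<open>Probability measures on a group and random walks\<close>

inductive_set semigroup_generated :: "('a, 'b) monoid_scheme \<Rightarrow> 'a set \<Rightarrow> 'a set"
  for G (structure) and S where
  generator: "g \<in> S \<Longrightarrow> g \<in> semigroup_generated G S"
| product: "\<lbrakk>g \<in> semigroup_generated G S; h \<in> semigroup_generated G S\<rbrakk>
    \<Longrightarrow> g \<otimes> h \<in> semigroup_generated G S"

definition convolution_pmf :: "('a, 'b) monoid_scheme \<Rightarrow> 'a pmf \<Rightarrow> 'a pmf \<Rightarrow> 'a pmf" where
  "convolution_pmf G \<mu> \<nu> = map_pmf (\<lambda>(g, h). g \<otimes>\<^bsub>G\<^esub> h) (pair_pmf \<mu> \<nu>)"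

primrec convolution_power :: "('a, 'b) monoid_scheme \<Rightarrow> 'a pmf \<Rightarrow> nat \<Rightarrow> 'a pmf" where
  "convolution_power G \<mu> 0 = return_pmf \<one>\<^bsub>G\<^esub>"
| "convolution_power G \<mu> (Suc l) = convolution_pmf G (convolution_power G \<mu> l) \<mu>"

definition nondegenerate :: "nat \<Rightarrow> (vertex \<Rightarrow> vertex) pmf \<Rightarrow> bool" where
  "nondegenerate q \<mu> \<longleftrightarrow> semigroup_generated (Aff q) (set_pmf \<mu>) = DA q"

definition aperiodic :: "nat \<Rightarrow> (vertex \<Rightarrow> vertex) pmf \<Rightarrow> bool" where
  "aperiodic q \<mu> \<longleftrightarrow> (\<forall>g\<in>DA q. \<forall>g'\<in>DA q. \<exists>l\<ge>1.
     {g, g'} \<subseteq> set_pmf (convolution_power (Aff q) \<mu> l))"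

text \<open>
  For \<open>\<mu>\<close> supported in the group, the image of \<open>\<mu>\<close> under inversion gives to \<open>g\<close> the mass
  \<open>\<mu>(g\<inverse>)\<close>.
\<close>

definition reflected :: "('a, 'b) monoid_scheme \<Rightarrow> 'a pmf \<Rightarrow> 'a pmf" where
  "reflected G \<mu> = map_pmf (\<lambda>g. inv\<^bsub>G\<^esub> g) \<mu>"

definition drift :: "(vertex \<Rightarrow> vertex) pmf \<Rightarrow> real" where
  "drift \<mu> = measure_pmf.expectation \<mu> (\<lambda>g. real_of_int (Phi g))"

text \<open>
  The increments live in the countable set \<open>DA q\<close> with all its subsets measurable. The restriction
  matters: on the uncountable type of all functions \<open>vertex \<Rightarrow> vertex\<close>, composition need not be
  measurable from the product of two discrete \<open>\<sigma>\<close>-algebras to the discrete \<open>\<sigma>\<close>-algebra.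
\<close>

definition increment_space :: "nat \<Rightarrow> (vertex \<Rightarrow> vertex) pmf \<Rightarrow> (nat \<Rightarrow> vertex \<Rightarrow> vertex) measure" where
  "increment_space q \<mu> = (\<Pi>\<^sub>M i\<in>UNIV. restrict_space (measure_pmf \<mu>) (DA q))"

text \<open>The increments are numbered from \<open>0\<close>: \<open>right_walk G x n = x 0 \<otimes> \<dots> \<otimes> x (n - 1)\<close>.\<close>

primrec right_walk :: "('a, 'b) monoid_scheme \<Rightarrow> (nat \<Rightarrow> 'a) \<Rightarrow> nat \<Rightarrow> 'a" where
  "right_walk G x 0 = \<one>\<^bsub>G\<^esub>"
| "right_walk G x (Suc n) = right_walk G x n \<otimes>\<^bsub>G\<^esub> x n"


section \<open>The harmonic measure\<close>

definition config_space :: "nat \<Rightarrow> (vertex \<Rightarrow> nat \<Rightarrow> nat) measure" where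
  "config_space q = (\<Pi>\<^sub>M v\<in>verts q. count_space (Sym q))"

text \<open>
  At vertices where the sequence of portraits is not eventually constant (almost surely there are
  none) the final configuration is given the value \<open>id\<close>.
\<close>

definition final_config ::
  "nat \<Rightarrow> (nat \<Rightarrow> vertex \<Rightarrow> vertex) \<Rightarrow> vertex \<Rightarrow> nat \<Rightarrow> nat" where
  "final_config q x = (\<lambda>v\<in>verts q.
     let limit = (\<lambda>\<sigma>. \<forall>\<^sub>F n in sequentially. portrait q (right_walk (Aff q) x n) v = \<sigma>)
     in if \<exists>\<sigma>. limit \<sigma> then THE \<sigma>. limit \<sigma> else id)"

definition harmonic_measure ::
  "nat \<Rightarrow> (vertex \<Rightarrow> vertex) pmf \<Rightarrow> (vertex \<Rightarrow> nat \<Rightarrow> nat) measure" where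
  "harmonic_measure q \<mu> = distr (increment_space q \<mu>) (config_space q) (final_config q)"

definition mutually_singular :: "'a measure \<Rightarrow> 'a measure \<Rightarrow> bool" where
  "mutually_singular M N \<longleftrightarrow> sets M = sets N \<and>
     (\<exists>A\<in>sets M. emeasure M A = 0 \<and> emeasure N (space N - A) = 0)"

end

(*
  The three measures are separated by the events E_s, for a sign s: the final configuration is
  trivial at every vertex v with s * height v large. Let m be the mean of Phi under mu, so that the
  reflected measure has drift -m. Since increments have nontrivial portraits at finitely many vertices
  only, the portrait at v can change at time n only if s * height v + s * Phi w_n <= K, with K fixed.

  If s * m > 0, then s * Phi w_n is almost surely bounded below (Hoeffding and Borel-Cantelli), so
  E_s has probability one.

  If s * m <= 0, then E_s has probability zero. By the central limit theorem s * Phi w_n <= -h has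
  probability at least a fixed delta for a suitable n depending on h, and at such a time triviality
  of the configuration at the vertex which w_n moves to o, whose height has absolute value at least
  h, forces the value at o of the final configuration of the future increments. But E_s does not
  depend on the first increments, so composing with an element that only changes the portrait at o
  shows that, if E_s had positive probability, no value at o could have the full probability of E_s.
  Existence of the limits when m = 0 rests on the transience of the walk on the vertices.
*)

theory Submission
  imports Defs
begin

section \<open>Vertices and the affine group\<close>

lemma mem_verts_iff:
  "v \<in> verts q \<longleftrightarrow> snd v \<in> extensional {..fst v} \<and> (\<forall>k\<le>fst v. snd v k < q) \<and>
     (\<exists>N. \<forall>k\<le>fst v. k \<le> N \<longrightarrow> snd v k = 0)"
  by (cases v) (auto simp: verts_def horosphere_def PiE_iff)

lemma vertex_eqI:
  assumes "v \<in> verts q" "w \<in> verts q" "fst v = fst w" "\<And>k. k \<le> fst v \<Longrightarrow> snd v k = snd w k"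
  shows "v = w"
  using assms by (intro prod_eqI extensionalityI[of _ "{..fst v}"]) (auto simp: mem_verts_iff)

lemma omega_verts: "q > 0 \<Longrightarrow> omega n \<in> verts q"
  by (auto simp: mem_verts_iff omega_def)

lemma parent_verts: "v \<in> verts q \<Longrightarrow> parent v \<in> verts q"
  unfolding mem_verts_iff parent_def
  by (auto simp: extensional_def) (metis less_imp_le)

lemma child_verts:
  assumes "v \<in> verts q" "t < q" shows "child v t \<in> verts q"
proof -
  obtain N where N: "\<forall>k\<le>fst v. k \<le> N \<longrightarrow> snd v k = 0"
    using assms by (auto simp: mem_verts_iff)
  have "\<forall>k\<le>fst v + 1. k \<le> min N (fst v) \<longrightarrow> ((snd v)(fst v + 1 := t)) k = 0"
    using N by auto
  then show ?thesis
    using assms unfolding mem_verts_iff child_def fst_conv snd_conv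
    by (intro conjI exI[of _ "min N (fst v)"]) (auto simp: extensional_def)
qed

lemma parent_child: "v \<in> verts q \<Longrightarrow> parent (child v t) = v"
  by (auto simp: parent_def child_def mem_verts_iff fun_eq_iff extensional_def restrict_def
      intro!: prod_eqI)

lemma child_last: "v \<in> verts q \<Longrightarrow> child (parent v) (snd v (fst v)) = v"
  by (auto simp: parent_def child_def mem_verts_iff fun_eq_iff extensional_def restrict_def
      intro!: prod_eqI)

lemma child_inject [simp]: "child v s = child v t \<longleftrightarrow> s = t"
  by (auto simp: child_def dest: fun_cong[where x = "fst v + 1"])

lemma fst_child [simp]: "fst (child v t) = fst v + 1"
  and fst_parent [simp]: "fst (parent v) = fst v - 1"
  and fst_omega [simp]: "fst (omega n) = - int n"
  by (simp_all add: child_def parent_def omega_def)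

lemma last_less: "v \<in> verts q \<Longrightarrow> snd v (fst v) < q"
  by (simp add: mem_verts_iff)

lemma children_eq:
  assumes "w \<in> verts q" "v \<in> verts q"
  shows "parent w = v \<longleftrightarrow> (\<exists>t<q. w = child v t)"
proof
  assume "parent w = v"
  then show "\<exists>t<q. w = child v t"
    using child_last[OF assms(1)] last_less[OF assms(1)] by auto
qed (use parent_child[OF assms(2)] in auto)

lemma parent_omega: "parent (omega n) = omega (Suc n)"
  by (auto simp: parent_def omega_def restrict_def fun_eq_iff)

lemma fst_funpow_parent [simp]: "fst ((parent ^^ n) v) = fst v - int n"
  by (induction n) auto

lemma funpow_parent_verts: "v \<in> verts q \<Longrightarrow> (parent ^^ n) v \<in> verts q"
  by (induction n) (auto simp: parent_verts)

lemma snd_funpow_parent: "k \<le> fst v - int n \<Longrightarrow> snd ((parent ^^ n) v) k = snd v k"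
  by (induction n) (auto simp: parent_def)

lemma ancestors_merge_omega:
  assumes "v \<in> verts q" "q > 0"
  obtains N where "\<And>n. n \<ge> N \<Longrightarrow> int n \<ge> fst v \<and> (parent ^^ n) v = omega (nat (int n - fst v))"
proof -
  obtain K where K: "\<And>k. k \<le> fst v \<Longrightarrow> k \<le> K \<Longrightarrow> snd v k = 0"
    using assms by (auto simp: mem_verts_iff)
  define N where "N = nat (\<bar>fst v\<bar> + \<bar>K\<bar>)"
  have "int n \<ge> fst v \<and> (parent ^^ n) v = omega (nat (int n - fst v))" if "n \<ge> N" for n
  proof
    show *: "int n \<ge> fst v" using that by (simp add: N_def)
    have "fst v - int n \<le> K" using that by (simp add: N_def)
    then show "(parent ^^ n) v = omega (nat (int n - fst v))"
      using * K assms
      by (intro vertex_eqI[of _ q] funpow_parent_verts omega_verts)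
        (auto simp: snd_funpow_parent omega_def)
  qed
  then show ?thesis by (rule that)
qed

lemma carrier_Aff_parent:
  assumes g: "g \<in> carrier (Aff q)" and v: "v \<in> verts q" and q: "q > 0"
  shows "g (parent v) = parent (g v)"
proof (rule ccontr)
  assume neq: "g (parent v) \<noteq> parent (g v)"
  have perm: "g permutes verts q"
    and adj: "\<And>v w. v \<in> verts q \<Longrightarrow> w \<in> verts q \<Longrightarrow> adjacent q (g v) (g w) = adjacent q v w"
    and se: "same_end (g \<circ> omega) omega"
    using g by (auto simp: Aff_def graph_automorphism_def)
  define a where "a n = (parent ^^ n) v" for n
  have aV: "a n \<in> verts q" for n unfolding a_def by (rule funpow_parent_verts[OF v])
  have aS: "a (Suc n) = parent (a n)" for n by (simp add: a_def)
  have step: "g (a n) = parent (g (a (Suc n))) \<or> g (a (Suc n)) = parent (g (a n))" for n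
    using adj[OF aV[of n] aV[of "Suc n"]] aV[of n] aV[of "Suc n"] aS[of n] by (auto simp: adjacent_def)
  \<comment> \<open>Once the image of the ray from \<open>v\<close> to the end descends, it cannot turn back.\<close>
  have down: "g (a n) = parent (g (a (Suc n)))" for n
  proof (induction n)
    case 0
    show ?case using step[of 0] neq by (auto simp: a_def)
  next
    case (Suc n)
    have "g (a (Suc (Suc n))) \<noteq> g (a n)"
    proof
      assume "g (a (Suc (Suc n))) = g (a n)"
      then have "fst (a (Suc (Suc n))) = fst (a n)"
        using permutes_inj[OF perm] by (simp add: inj_eq)
      then show False by (simp add: a_def)
    qed
    then show ?case using step[of "Suc n"] Suc by auto
  qed
  obtain N where N: "\<And>n. n \<ge> N \<Longrightarrow> int n \<ge> fst v \<and> a n = omega (nat (int n - fst v))"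
    unfolding a_def using ancestors_merge_omega[OF v q] by blast
  obtain i j where ij: "\<And>n. g (omega (i + n)) = omega (j + n)"
    using se by (auto simp: same_end_def)
  define n where "n = N + i + nat \<bar>fst v\<bar>"
  define d where "d = nat (int n - fst v) - i"
  have "a n = omega (i + d)" "a (Suc n) = omega (i + Suc d)"
    using N[of n] N[of "Suc n"] unfolding n_def d_def by (auto intro!: arg_cong[where f = omega])
  then have "g (a n) = omega (j + d)" "g (a (Suc n)) = omega (j + Suc d)"
    using ij[of d] ij[of "Suc d"] by auto
  then have "fst (g (a (Suc n))) = fst (g (a n)) - 1" by simp
  moreover have "fst (g (a n)) = fst (g (a (Suc n))) - 1"
    using down[of n] by simp
  ultimately show False by simp
qed

lemma carrier_Aff_iff:
  assumes q: "q > 0"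
  shows "g \<in> carrier (Aff q) \<longleftrightarrow>
    g permutes verts q \<and> (\<forall>v\<in>verts q. g (parent v) = parent (g v))"
proof
  assume "g \<in> carrier (Aff q)"
  then show "g permutes verts q \<and> (\<forall>v\<in>verts q. g (parent v) = parent (g v))"
    using carrier_Aff_parent[OF _ _ q] by (auto simp: Aff_def graph_automorphism_def)
next
  assume a: "g permutes verts q \<and> (\<forall>v\<in>verts q. g (parent v) = parent (g v))"
  then have perm: "g permutes verts q" and par: "\<And>v. v \<in> verts q \<Longrightarrow> g (parent v) = parent (g v)"
    by auto
  have "adjacent q (g v) (g w) \<longleftrightarrow> adjacent q v w" if "v \<in> verts q" "w \<in> verts q" for v w
    using that par[OF that(1)] par[OF that(2)] permutes_inj[OF perm] permutes_in_image[OF perm]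
    unfolding adjacent_def inj_def by metis
  moreover have "same_end (g \<circ> omega) omega"
  proof -
    have go: "g (omega 0) \<in> verts q"
      using permutes_in_image[OF perm] omega_verts[OF q] by auto
    have pw: "g (omega n) = (parent ^^ n) (g (omega 0))" for n
    proof (induction n)
      case (Suc n)
      then show ?case using par[OF omega_verts[OF q], of n] by (simp add: parent_omega)
    qed auto
    obtain N where N: "\<And>n. n \<ge> N \<Longrightarrow> int n \<ge> fst (g (omega 0)) \<and>
        (parent ^^ n) (g (omega 0)) = omega (nat (int n - fst (g (omega 0))))"
      using ancestors_merge_omega[OF go q] by blast
    have "(g \<circ> omega) (N + n) = omega (nat (int N - fst (g (omega 0))) + n)" for n
    proof -
      have "nat (int (N + n) - fst (g (omega 0))) = nat (int N - fst (g (omega 0))) + n"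
        using N[of N] by auto
      then show ?thesis using N[of "N + n"] pw[of "N + n"] by simp
    qed
    then show ?thesis unfolding same_end_def by blast
  qed
  ultimately show "g \<in> carrier (Aff q)"
    using perm by (auto simp: Aff_def graph_automorphism_def)
qed

lemma mult_Aff [simp]: "g \<otimes>\<^bsub>Aff q\<^esub> h = h \<circ> g"
  and one_Aff [simp]: "\<one>\<^bsub>Aff q\<^esub> = id"
  by (simp_all add: Aff_def)

lemma inv_carrier_Aff:
  assumes "q > 0" "g \<in> carrier (Aff q)"
  shows "Hilbert_Choice.inv g \<in> carrier (Aff q)"
proof -
  have perm: "g permutes verts q" and par: "\<And>v. v \<in> verts q \<Longrightarrow> g (parent v) = parent (g v)"
    using assms by (auto simp: carrier_Aff_iff)
  have "Hilbert_Choice.inv g (parent v) = parent (Hilbert_Choice.inv g v)" if "v \<in> verts q" for v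
  proof -
    have "Hilbert_Choice.inv g v \<in> verts q"
      using permutes_in_image[OF permutes_inv[OF perm]] that by auto
    from par[OF this] show ?thesis
      using permutes_inverses[OF perm] by metis
  qed
  then show ?thesis using assms permutes_inv[OF perm] by (auto simp: carrier_Aff_iff)
qed

lemma group_Aff:
  assumes q: "q > 0" shows "group (Aff q)"
proof (rule groupI)
  show "\<exists>y\<in>carrier (Aff q). y \<otimes>\<^bsub>Aff q\<^esub> x = \<one>\<^bsub>Aff q\<^esub>" if "x \<in> carrier (Aff q)" for x
  proof (rule bexI)
    show "Hilbert_Choice.inv x \<otimes>\<^bsub>Aff q\<^esub> x = \<one>\<^bsub>Aff q\<^esub>"
      using that q by (auto simp: carrier_Aff_iff fun_eq_iff permutes_inverses)
  qed (rule inv_carrier_Aff[OF q that])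
next
  fix x y assume "x \<in> carrier (Aff q)" "y \<in> carrier (Aff q)"
  then show "x \<otimes>\<^bsub>Aff q\<^esub> y \<in> carrier (Aff q)"
    using q by (auto simp: carrier_Aff_iff permutes_compose permutes_in_image)
qed (use q in \<open>auto simp: carrier_Aff_iff permutes_id\<close>)

lemma m_inv_Aff:
  assumes "q > 0" "g \<in> carrier (Aff q)"
  shows "inv\<^bsub>Aff q\<^esub> g = Hilbert_Choice.inv g"
proof (rule group.inv_equality[OF group_Aff[OF assms(1)] _ assms(2) inv_carrier_Aff[OF assms]])
  show "Hilbert_Choice.inv g \<otimes>\<^bsub>Aff q\<^esub> g = \<one>\<^bsub>Aff q\<^esub>"
    using assms by (auto simp: carrier_Aff_iff fun_eq_iff permutes_inverses)
qed

lemma Aff_verts: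
  assumes "q > 0" "g \<in> carrier (Aff q)" shows "g v \<in> verts q \<longleftrightarrow> v \<in> verts q"
  using assms by (auto simp: carrier_Aff_iff permutes_in_image)

lemma Aff_inverses:
  assumes "q > 0" "g \<in> carrier (Aff q)"
  shows "g (Hilbert_Choice.inv g v) = v" "Hilbert_Choice.inv g (g v) = v"
  using assms by (auto simp: carrier_Aff_iff permutes_inverses)

lemma Aff_height:
  assumes q: "q > 0" and g: "g \<in> carrier (Aff q)" and v: "v \<in> verts q"
  shows "fst (g v) = fst v + Phi g"
proof -
  have par: "\<And>v. v \<in> verts q \<Longrightarrow> g (parent v) = parent (g v)"
    using g q by (auto simp: carrier_Aff_iff)
  have pw: "g ((parent ^^ n) u) = (parent ^^ n) (g u)" if "u \<in> verts q" for n u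
    by (induction n) (use par funpow_parent_verts[OF that] in auto)
  obtain N where "(parent ^^ N) v = omega (nat (int N - fst v))" "int N \<ge> fst v"
    using ancestors_merge_omega[OF v q] by blast
  moreover have "omega n = (parent ^^ n) (omega 0)" for n
    by (induction n) (simp_all flip: parent_omega)
  ultimately have "(parent ^^ N) (g v) = (parent ^^ nat (int N - fst v)) (g (omega 0))"
    using pw[OF v, of N] pw[OF omega_verts[OF q, of 0]] by metis
  from arg_cong[OF this, of fst] show ?thesis
    using \<open>int N \<ge> fst v\<close> by (simp add: Phi_def height_def)
qed

lemma Phi_comp:
  assumes "q > 0" "g \<in> carrier (Aff q)" "h \<in> carrier (Aff q)"
  shows "Phi (h \<circ> g) = Phi g + Phi h"
proof -
  have "fst (h (g (omega 0))) = fst (g (omega 0)) + Phi h"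
    using assms by (intro Aff_height) (auto simp: Aff_verts omega_verts)
  then show ?thesis by (simp add: Phi_def height_def)
qed

lemma Phi_id [simp]: "Phi id = 0"
  by (simp add: Phi_def)

lemma Phi_inv:
  assumes "q > 0" "g \<in> carrier (Aff q)"
  shows "Phi (inv\<^bsub>Aff q\<^esub> g) = - Phi g"
proof -
  have "Phi (Hilbert_Choice.inv g \<circ> g) = Phi g + Phi (Hilbert_Choice.inv g)"
    using assms by (intro Phi_comp inv_carrier_Aff)
  moreover have "Hilbert_Choice.inv g \<circ> g = id"
    using assms by (auto simp: Aff_inverses)
  ultimately show ?thesis using assms by (simp add: m_inv_Aff)
qed

section \<open>Portraits\<close>

locale regular_tree =
  fixes q :: nat
  assumes q_ge_2: "q \<ge> 2"
begin

lemma q_pos: "q > 0"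
  using q_ge_2 by simp

abbreviation "V \<equiv> verts q"
abbreviation "AffT \<equiv> carrier (Aff q)"

lemmas Aff_iff = carrier_Aff_iff[OF q_pos]
lemmas Aff_verts_iff [simp] = Aff_verts[OF q_pos]

lemma Aff_comp: "g \<in> AffT \<Longrightarrow> h \<in> AffT \<Longrightarrow> h \<circ> g \<in> AffT"
  using monoid.m_closed[OF group.is_monoid[OF group_Aff[OF q_pos]], of g h]
  by simp

lemma Aff_id: "id \<in> AffT"
  using monoid.one_closed[OF group.is_monoid[OF group_Aff[OF q_pos]]] by simp

lemma Aff_inj: "g \<in> AffT \<Longrightarrow> inj g"
  using permutes_inj by (auto simp: Aff_iff)

lemma Sym_eqI:
  assumes "\<sigma> \<in> Sym q" "\<tau> \<in> Sym q" "\<And>t. t < q \<Longrightarrow> \<sigma> t = \<tau> t"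
  shows "\<sigma> = \<tau>"
  using assms by (auto simp: Sym_def permutes_def fun_eq_iff) (metis lessThan_iff)

lemma Sym_less: "\<sigma> \<in> Sym q \<Longrightarrow> \<sigma> t < q \<longleftrightarrow> t < q"
  using permutes_in_image[of \<sigma> "{..<q}" t] by (auto simp: Sym_def)

lemma finite_Sym: "finite (Sym q)"
  using finite_permutations[of "{..<q}"] by (simp add: Sym_def)

lemma id_Sym: "id \<in> Sym q"
  by (simp add: Sym_def permutes_id)

lemma Sym_comp: "\<sigma> \<in> Sym q \<Longrightarrow> \<tau> \<in> Sym q \<Longrightarrow> \<sigma> \<circ> \<tau> \<in> Sym q"
  by (simp add: Sym_def permutes_compose)

lemma local_action_ex:
  assumes g: "g \<in> AffT" and v: "v \<in> V"
  shows "\<exists>\<sigma>\<in>Sym q. \<forall>t<q. g (child v t) = child (g v) (\<sigma> t)"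
proof -
  have ex: "\<exists>s<q. g (child v t) = child (g v) s" if "t < q" for t
  proof -
    have c: "child v t \<in> V" using child_verts[OF v that] .
    then have "parent (g (child v t)) = g v"
      using g parent_child[OF v, of t] by (auto simp: Aff_iff)
    then show ?thesis using children_eq[of "g (child v t)" q "g v"] c g v by simp
  qed
  then obtain f where f: "\<And>t. t < q \<Longrightarrow> f t < q \<and> g (child v t) = child (g v) (f t)"
    by metis
  define \<sigma> where "\<sigma> t = (if t < q then f t else t)" for t
  have "inj_on \<sigma> {..<q}"
  proof (rule inj_onI)
    fix s t assume "s \<in> {..<q}" "t \<in> {..<q}" "\<sigma> s = \<sigma> t"
    then have "g (child v s) = g (child v t)" using f[of s] f[of t] by (simp add: \<sigma>_def)
    then show "s = t" using Aff_inj[OF g] by (simp add: inj_eq)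
  qed
  moreover have "\<sigma> ` {..<q} \<subseteq> {..<q}" using f by (auto simp: \<sigma>_def)
  ultimately have "bij_betw \<sigma> {..<q} {..<q}"
    by (simp add: bij_betw_def endo_inj_surj)
  then have "\<sigma> permutes {..<q}" by (rule bij_imp_permutes) (simp add: \<sigma>_def)
  then show ?thesis using f by (auto simp: Sym_def \<sigma>_def intro!: bexI[of _ \<sigma>])
qed

lemma hor_portrait_unique:
  assumes "\<sigma> \<in> Sym q" "\<And>t. t < q \<Longrightarrow> g (child v t) = child (g v) (\<sigma> t)"
  shows "hor_portrait q g v = \<sigma>"
  unfolding hor_portrait_def
proof (rule the_equality)
  fix \<tau> assume "\<tau> \<in> Sym q \<and> (\<forall>t<q. g (child v t) = child (g v) (\<tau> t))"
  then show "\<tau> = \<sigma>" using assms by (intro Sym_eqI) auto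
qed (use assms in auto)

definition label_preserving :: "(vertex \<Rightarrow> vertex) \<Rightarrow> bool" where
  "label_preserving g \<longleftrightarrow> g \<in> AffT \<and> (\<forall>v\<in>V. \<forall>t<q. g (child v t) = child (g v) t)"

lemma label_preserving_comp:
  assumes "label_preserving g" "label_preserving h"
  shows "label_preserving (h \<circ> g)"
  using assms by (auto simp: label_preserving_def Aff_comp)

lemma label_preserving_inv:
  assumes "label_preserving g"
  shows "label_preserving (inv\<^bsub>Aff q\<^esub> g)"
proof -
  have g: "g \<in> AffT" using assms by (simp add: label_preserving_def)
  let ?h = "Hilbert_Choice.inv g"
  have h: "?h \<in> AffT" by (rule inv_carrier_Aff[OF q_pos g])
  have "?h (child v t) = child (?h v) t" if "v \<in> V" "t < q" for v t
  proof -
    have "g (child (?h v) t) = child v t"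
      using assms that h Aff_inverses[OF q_pos g] by (simp add: label_preserving_def)
    then show ?thesis using Aff_inverses[OF q_pos g] by metis
  qed
  then show ?thesis using h by (simp add: label_preserving_def m_inv_Aff[OF q_pos g])
qed

lemma tree_shift_verts: "v \<in> V \<Longrightarrow> tree_shift q v \<in> V"
proof -
  assume v: "v \<in> V"
  obtain N where "\<forall>k\<le>fst v. k \<le> N \<longrightarrow> snd v k = 0"
    using v by (auto simp: mem_verts_iff)
  moreover have "tree_shift q v = (fst v + 1, \<lambda>k\<in>{..fst v + 1}. snd v (k - 1))"
    using v by (simp add: tree_shift_def)
  ultimately show ?thesis
    using v unfolding mem_verts_iff by (intro conjI exI[of _ "N + 1"]) auto
qed

lemma tree_shift_permutes: "tree_shift q permutes V"
proof (rule bij_imp_permutes)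
  define u :: "vertex \<Rightarrow> vertex" where "u v = (fst v - 1, \<lambda>k\<in>{..fst v - 1}. snd v (k + 1))" for v
  have uV: "u v \<in> V" if v: "v \<in> V" for v
  proof -
    obtain N where "\<forall>k\<le>fst v. k \<le> N \<longrightarrow> snd v k = 0"
      using v by (auto simp: mem_verts_iff)
    then show ?thesis using v unfolding mem_verts_iff u_def
      by (intro conjI exI[of _ "N - 1"]) auto
  qed
  show "bij_betw (tree_shift q) V V"
  proof (rule bij_betw_byWitness[of _ u])
    have sh: "tree_shift q v = (fst v + 1, \<lambda>k\<in>{..fst v + 1}. snd v (k - 1))" if "v \<in> V" for v
      using that by (simp add: tree_shift_def)
    show "\<forall>v\<in>V. u (tree_shift q v) = v"
    proof
      fix v assume v: "v \<in> V"
      show "u (tree_shift q v) = v"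
        by (rule vertex_eqI[of _ q]) (use v uV[OF tree_shift_verts[OF v]] sh[OF v] in \<open>simp_all add: u_def\<close>)
    qed
    show "\<forall>v\<in>V. tree_shift q (u v) = v"
    proof
      fix v assume v: "v \<in> V"
      show "tree_shift q (u v) = v"
        by (rule vertex_eqI[of _ q])
          (use v tree_shift_verts[OF uV[OF v]] sh[OF uV[OF v]] in \<open>simp_all add: u_def\<close>)
    qed
  qed (use uV tree_shift_verts in auto)
qed (simp add: tree_shift_def)

lemma tree_shift_child:
  assumes "v \<in> V" "t < q" shows "tree_shift q (child v t) = child (tree_shift q v) t"
proof (rule vertex_eqI[of _ q])
  show "tree_shift q (child v t) \<in> V" "child (tree_shift q v) t \<in> V"
    using assms by (auto intro!: tree_shift_verts child_verts)
  show "fst (tree_shift q (child v t)) = fst (child (tree_shift q v) t)"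
    using assms child_verts[OF assms] by (simp add: tree_shift_def)
  show "snd (tree_shift q (child v t)) k = snd (child (tree_shift q v) t) k"
    if "k \<le> fst (tree_shift q (child v t))" for k
    using assms child_verts[OF assms] that by (auto simp: tree_shift_def child_def)
qed

lemma label_preserving_shift: "label_preserving (tree_shift q)"
proof -
  have "tree_shift q (parent v) = parent (tree_shift q v)" if v: "v \<in> V" for v
    using tree_shift_child[OF parent_verts[OF v] last_less[OF v]]
      parent_child[OF tree_shift_verts[OF parent_verts[OF v]]] child_last[OF v] by metis
  then show ?thesis
    using tree_shift_permutes tree_shift_child by (auto simp: label_preserving_def Aff_iff)
qed

lemma Phi_shift: "Phi (tree_shift q) = 1"
  using omega_verts[OF q_pos, of 0] by (simp add: Phi_def height_def tree_shift_def)

lemma shift_nat_pow: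
  "label_preserving (tree_shift q [^]\<^bsub>Aff q\<^esub> (n::nat)) \<and> Phi (tree_shift q [^]\<^bsub>Aff q\<^esub> n) = int n"
proof (induction n)
  case 0
  have "label_preserving id" using Aff_id by (simp add: label_preserving_def)
  then show ?case by (simp add: id_def[symmetric] del: id_apply)
next
  case (Suc n)
  then show ?case
    using label_preserving_comp[OF _ label_preserving_shift] Phi_shift label_preserving_shift
      Phi_comp[OF q_pos, of "tree_shift q [^]\<^bsub>Aff q\<^esub> n" "tree_shift q"]
    by (simp add: label_preserving_def del: o_apply)
qed

lemma shift_int_pow:
  "label_preserving (tree_shift q [^]\<^bsub>Aff q\<^esub> (k::int)) \<and> Phi (tree_shift q [^]\<^bsub>Aff q\<^esub> k) = k"
proof (cases "k < 0")
  case True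
  have "tree_shift q [^]\<^bsub>Aff q\<^esub> nat (- k) \<in> AffT"
    using shift_nat_pow by (simp add: label_preserving_def)
  then have "Phi (inv\<^bsub>Aff q\<^esub> (tree_shift q [^]\<^bsub>Aff q\<^esub> nat (- k))) = k"
    using Phi_inv[OF q_pos] shift_nat_pow[of "nat (- k)"] True by auto
  moreover have "tree_shift q [^]\<^bsub>Aff q\<^esub> k = inv\<^bsub>Aff q\<^esub> (tree_shift q [^]\<^bsub>Aff q\<^esub> nat (- k))"
    unfolding int_pow_def2 using True by (rule if_P)
  ultimately show ?thesis
    using label_preserving_inv shift_nat_pow by metis
next
  case False
  then have "tree_shift q [^]\<^bsub>Aff q\<^esub> k = tree_shift q [^]\<^bsub>Aff q\<^esub> nat k"
    unfolding int_pow_def2 by (rule if_not_P)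
  then show ?thesis using shift_nat_pow[of "nat k"] False by (metis int_nat_eq not_less)
qed

lemma Hor_iff: "g \<in> Hor q \<longleftrightarrow> g \<in> AffT \<and> Phi g = 0"
  by (simp add: Hor_def)

lemma hor_part_eq:
  assumes g: "g \<in> AffT"
  shows "hor_part q g = inv\<^bsub>Aff q\<^esub> (tree_shift q [^]\<^bsub>Aff q\<^esub> Phi g) \<circ> g"
proof -
  define a where "a k = tree_shift q [^]\<^bsub>Aff q\<^esub> (k::int)" for k
  have a: "a k \<in> AffT" "Phi (a k) = k" for k
    using shift_int_pow[of k] by (auto simp: label_preserving_def a_def)
  have ainv: "inv\<^bsub>Aff q\<^esub> (a k) \<in> AffT" for k
    using a(1) q_pos inv_carrier_Aff by (simp add: m_inv_Aff)
  have cancel: "inv\<^bsub>Aff q\<^esub> (a k) \<circ> a k = id" "a k \<circ> inv\<^bsub>Aff q\<^esub> (a k) = id" for k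
    using Aff_inverses[OF q_pos a(1)[of k]] by (auto simp: m_inv_Aff[OF q_pos a(1)])
  show ?thesis unfolding hor_part_def a_def[symmetric] mult_Aff
  proof (rule the_equality, intro conjI exI)
    show "inv\<^bsub>Aff q\<^esub> (a (Phi g)) \<circ> g \<in> Hor q"
      using g a ainv by (simp add: Hor_iff Aff_comp Phi_comp[OF q_pos] Phi_inv[OF q_pos])
    show "g = a (Phi g) \<circ> (inv\<^bsub>Aff q\<^esub> (a (Phi g)) \<circ> g)"
      unfolding o_assoc cancel(2) by simp
    fix \<gamma> assume "\<gamma> \<in> Hor q \<and> (\<exists>m. g = a m \<circ> \<gamma>)"
    then obtain m where "\<gamma> \<in> Hor q" and m: "g = a m \<circ> \<gamma>" by auto
    then have "Phi g = m" using a by (simp add: Hor_iff Phi_comp[OF q_pos])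
    then show "\<gamma> = inv\<^bsub>Aff q\<^esub> (a (Phi g)) \<circ> g"
      using cancel(1)[of m] unfolding m \<open>Phi g = m\<close>[unfolded m] o_assoc by simp
  qed
qed

lemma portrait_props:
  assumes g: "g \<in> AffT" and v: "v \<in> V"
  shows portrait_Sym: "portrait q g v \<in> Sym q"
    and portrait_child: "\<And>t. t < q \<Longrightarrow> g (child v t) = child (g v) (portrait q g v t)"
proof -
  obtain \<sigma> where \<sigma>: "\<sigma> \<in> Sym q" "\<And>t. t < q \<Longrightarrow> g (child v t) = child (g v) (\<sigma> t)"
    using local_action_ex[OF g v] by auto
  have "label_preserving (inv\<^bsub>Aff q\<^esub> (tree_shift q [^]\<^bsub>Aff q\<^esub> Phi g))"
    using shift_int_pow[of "Phi g"] label_preserving_inv by blast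
  then have "hor_portrait q (hor_part q g) v = \<sigma>"
    using \<sigma> g v by (intro hor_portrait_unique) (auto simp: hor_part_eq label_preserving_def Sym_less)
  then show "portrait q g v \<in> Sym q" "\<And>t. t < q \<Longrightarrow> g (child v t) = child (g v) (portrait q g v t)"
    using \<sigma> by (auto simp: portrait_def)
qed

lemma portrait_unique:
  assumes "g \<in> AffT" "v \<in> V" "\<sigma> \<in> Sym q" "\<And>t. t < q \<Longrightarrow> g (child v t) = child (g v) (\<sigma> t)"
  shows "portrait q g v = \<sigma>"
  using assms portrait_Sym[OF assms(1,2)] portrait_child[OF assms(1,2)]
  by (intro Sym_eqI) (auto)

lemma portrait_comp:
  assumes "g \<in> AffT" "h \<in> AffT" "v \<in> V"
  shows "portrait q (h \<circ> g) v = portrait q h (g v) \<circ> portrait q g v"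
  using assms
  by (intro portrait_unique Aff_comp Sym_comp portrait_Sym) (auto simp: portrait_child portrait_Sym Sym_less)

lemma portrait_label_preserving: "label_preserving g \<Longrightarrow> v \<in> V \<Longrightarrow> portrait q g v = id"
  by (intro portrait_unique id_Sym) (auto simp: label_preserving_def)

lemma label_preserving_DA:
  assumes "label_preserving g" shows "g \<in> DA q"
proof -
  have "{v \<in> V. portrait q g v \<noteq> id} = {}"
    using portrait_label_preserving[OF assms] by blast
  then have "finite {v \<in> V. portrait q g v \<noteq> id}" by (metis finite.emptyI)
  then show ?thesis using assms by (simp add: DA_def label_preserving_def)
qed

lemma shift_DA: "tree_shift q \<in> DA q"
  by (intro label_preserving_DA label_preserving_shift)

lemma id_DA: "id \<in> DA q"
  using Aff_id by (intro label_preserving_DA) (auto simp: label_preserving_def)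

lemma DA_Aff: "g \<in> DA q \<Longrightarrow> g \<in> AffT"
  by (simp add: DA_def)


section \<open>Transitivity of the discrete affine group\<close>

text \<open>Exchanges the subtrees rooted at the children \<open>0\<close> and \<open>t\<close> of \<open>p\<close>.\<close>

definition swap :: "vertex \<Rightarrow> nat \<Rightarrow> vertex \<Rightarrow> vertex" where
  "swap p t v =
     (if v \<in> V \<and> fst p < fst v \<and> (\<forall>k\<le>fst p. snd v k = snd p k)
      then (fst v, (snd v)(fst p + 1 := Transposition.transpose 0 t (snd v (fst p + 1)))) else v)"

lemma transpose_less: "t < q \<Longrightarrow> Transposition.transpose 0 t s < q \<longleftrightarrow> s < (q::nat)"
  by (auto simp: Transposition.transpose_def)

lemma swap_verts:
  assumes "v \<in> V" "t < q" shows "swap p t v \<in> V"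
proof -
  obtain N where N: "\<forall>k\<le>fst v. k \<le> N \<longrightarrow> snd v k = 0"
    using assms by (auto simp: mem_verts_iff)
  have ex: "\<exists>N. \<forall>k\<le>fst v. k \<le> N \<longrightarrow> ((snd v)(fst p + 1 := s)) k = 0" for s
    using N by (intro exI[of _ "min N (fst p)"]) auto
  show ?thesis using assms ex transpose_less[OF assms(2)]
    unfolding swap_def by (auto simp: mem_verts_iff extensional_def)
qed

lemma swap_swap: "t < q \<Longrightarrow> swap p t (swap p t v) = v"
  using swap_verts[of v t p] by (auto simp: swap_def)

lemma swap_permutes: "t < q \<Longrightarrow> swap p t permutes V"
proof (rule bij_imp_permutes)
  assume "t < q"
  then show "bij_betw (swap p t) V V"
    by (intro bij_betw_byWitness[of _ "swap p t"]) (auto simp: swap_swap swap_verts)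
qed (auto simp: swap_def)

lemma swap_child:
  assumes "v \<in> V" "p \<in> V" "t < q" "s < q"
  shows "swap p t (child v s) = child (swap p t v) (if v = p then Transposition.transpose 0 t s else s)"
proof (cases "v = p")
  case True
  then show ?thesis using assms child_verts[of v q s] by (auto simp: swap_def child_def fun_eq_iff)
next
  case False
  consider "fst p < fst v" | "fst p = fst v" | "fst p > fst v" by linarith
  then show ?thesis
  proof cases
    case 1
    then show ?thesis using assms child_verts[of v q s] False by (auto simp: swap_def child_def)
  next
    case 2
    then have "\<not> (\<forall>k\<le>fst p. snd v k = snd p k)"
      using False vertex_eqI[OF assms(1,2)] by auto
    then show ?thesis using assms child_verts[of v q s] False 2 by (auto simp: swap_def child_def)
  next
    case 3
    then show ?thesis using assms child_verts[of v q s] False by (auto simp: swap_def child_def)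
  qed
qed

lemma swap_Aff:
  assumes "p \<in> V" "t < q" shows "swap p t \<in> AffT"
proof -
  have "swap p t (parent v) = parent (swap p t v)" if v: "v \<in> V" for v
    using swap_child[OF parent_verts[OF v] assms last_less[OF v]]
      parent_child[OF swap_verts[OF parent_verts[OF v] assms(2)]] child_last[OF v] by metis
  then show ?thesis using swap_permutes[OF assms(2)] by (auto simp: Aff_iff)
qed

lemma portrait_swap:
  assumes "p \<in> V" "t < q" "v \<in> V"
  shows "portrait q (swap p t) v = (if v = p then Transposition.transpose 0 t else id)"
proof -
  have "Transposition.transpose 0 t \<in> Sym q"
    using assms q_pos by (auto simp: Sym_def intro!: permutes_swap_id)
  then show ?thesis
    using assms by (intro portrait_unique swap_Aff) (auto simp: swap_child id_Sym)
qed

lemma swap_DA: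
  assumes "p \<in> V" "t < q" shows "swap p t \<in> DA q"
proof -
  have "{v \<in> V. portrait q (swap p t) v \<noteq> id} \<subseteq> {p}" using assms by (auto simp: portrait_swap)
  then show ?thesis using swap_Aff[OF assms] finite_subset by (auto simp: DA_def)
qed

lemma DA_comp:
  assumes "g \<in> DA q" "h \<in> DA q" shows "h \<circ> g \<in> DA q"
proof -
  note A = assms[THEN DA_Aff]
  let ?S = "\<lambda>g. {v \<in> V. portrait q g v \<noteq> id}"
  have "?S (h \<circ> g) \<subseteq> ?S g \<union> g -` ?S h"
    using A by (auto simp: portrait_comp)
  moreover have "finite (?S g \<union> g -` ?S h)"
    using assms finite_vimageI[OF _ Aff_inj[OF A(1)], of "?S h"] by (simp add: DA_def)
  ultimately have "finite (?S (h \<circ> g))" by (rule finite_subset)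
  then show ?thesis using Aff_comp[OF A] by (simp add: DA_def del: o_apply)
qed

definition base_vertex :: "int \<Rightarrow> vertex" where
  "base_vertex m = (m, \<lambda>k\<in>{..m}. 0)"

lemma base_vertex_verts: "base_vertex m \<in> V"
  using q_pos by (auto simp: base_vertex_def mem_verts_iff)

lemma DA_base_vertex:
  assumes "v \<in> V"
  shows "(\<exists>g\<in>DA q. g v = base_vertex (fst v)) \<and> (\<exists>g\<in>DA q. g (base_vertex (fst v)) = v)"
proof -
  have main: "(\<exists>g\<in>DA q. g v = base_vertex (fst v)) \<and> (\<exists>g\<in>DA q. g (base_vertex (fst v)) = v)"
    if "v \<in> V" "\<And>k. k \<le> fst v - int n \<Longrightarrow> snd v k = 0" for v n
    using that
  proof (induction n arbitrary: v)
    case 0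
    then have "v = base_vertex (fst v)"
      by (intro vertex_eqI[of _ q] base_vertex_verts) (auto simp: base_vertex_def)
    then show ?case using id_DA by (metis id_apply)
  next
    case (Suc n)
    define p where "p = (parent ^^ Suc n) v"
    define t where "t = snd v (fst v - int n)"
    define w where "w = swap p t v"
    have p: "p \<in> V" unfolding p_def by (rule funpow_parent_verts[OF Suc.prems(1)])
    have t: "t < q" using Suc.prems(1) by (simp add: t_def mem_verts_iff)
    have w: "w \<in> V" "fst w = fst v"
      using swap_verts[OF Suc.prems(1) t] by (auto simp: w_def swap_def)
    have "fst p + 1 = fst v - int n" "fst p < fst v" "\<forall>k\<le>fst p. snd v k = snd p k"
      using snd_funpow_parent[of _ v "Suc n"] by (auto simp: p_def simp del: funpow.simps)
    then have "w = (fst v, (snd v)(fst v - int n := 0))"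
      using Suc.prems(1) by (auto simp: w_def swap_def t_def)
    then have "snd w k = 0" if "k \<le> fst w - int n" for k
      using that Suc.prems(2)[of k] by auto
    from Suc.IH[OF w(1) this] obtain g h where gh: "g \<in> DA q" "h \<in> DA q"
      "g w = base_vertex (fst v)" "h (base_vertex (fst v)) = w" using w by auto
    have "swap p t w = v" using swap_swap[OF t] by (simp add: w_def)
    then show ?case
      using DA_comp[OF swap_DA[OF p t] gh(1)] DA_comp[OF gh(2) swap_DA[OF p t]] gh(3,4)
      by (intro conjI bexI[of _ "g \<circ> swap p t"] bexI[of _ "swap p t \<circ> h"]) (simp_all add: w_def)
  qed
  obtain N where N: "\<And>k. k \<le> fst v \<Longrightarrow> k \<le> N \<Longrightarrow> snd v k = 0"
    using assms by (auto simp: mem_verts_iff)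
  show ?thesis by (rule main[of v "nat (fst v - N)"]) (use assms N in \<open>auto split: if_splits\<close>)
qed

lemma DA_child:
  assumes "v \<in> V" "t < q"
  obtains g where "g \<in> DA q" "g v = child v t"
proof -
  obtain g h where "g \<in> DA q" "g v = base_vertex (fst v)"
    "h \<in> DA q" "h (base_vertex (fst v + 1)) = child v t"
    using DA_base_vertex[OF assms(1)] DA_base_vertex[OF child_verts[OF assms]] by auto
  moreover have "tree_shift q (base_vertex (fst v)) = base_vertex (fst v + 1)"
    using base_vertex_verts by (auto simp: tree_shift_def base_vertex_def fun_eq_iff)
  ultimately show ?thesis
    using that[of "h \<circ> (tree_shift q \<circ> g)"] by (auto simp: DA_comp shift_DA)
qed

lemma countable_verts: "countable V"
proof -
  define f :: "int \<times> nat list \<Rightarrow> vertex" where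
    "f = (\<lambda>(m, xs). (m, \<lambda>k\<in>{..m}. if nat (m - k) < length xs then xs ! nat (m - k) else 0))"
  have "v \<in> range f" if v: "v \<in> V" for v
  proof -
    obtain N where N: "\<And>k. k \<le> fst v \<Longrightarrow> k \<le> N \<Longrightarrow> snd v k = 0"
      using v by (auto simp: mem_verts_iff)
    have "v = f (fst v, map (\<lambda>i. snd v (fst v - int i)) [0..<nat (fst v - N)])" (is "_ = ?w")
    proof (rule prod_eqI)
      show "snd v = snd ?w"
      proof
        fix k show "snd v k = snd ?w k"
          using N[of k] v by (cases "k \<le> fst v") (auto simp: f_def mem_verts_iff extensional_def)
      qed
    qed (simp add: f_def)
    then show ?thesis by blast
  qed
  then have "V \<subseteq> range f" by blast
  then show ?thesis by (rule countable_subset) simp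
qed


section \<open>Trajectories\<close>

abbreviation "walk \<equiv> right_walk (Aff q)"

abbreviation shift_seq :: "nat \<Rightarrow> (nat \<Rightarrow> 'a) \<Rightarrow> nat \<Rightarrow> 'a" where
  "shift_seq n x \<equiv> \<lambda>i. x (n + i)"

abbreviation limit_portrait :: "(nat \<Rightarrow> vertex \<Rightarrow> vertex) \<Rightarrow> vertex \<Rightarrow> (nat \<Rightarrow> nat) \<Rightarrow> bool" where
  "limit_portrait x v \<sigma> \<equiv> \<forall>\<^sub>F n in sequentially. portrait q (walk x n) v = \<sigma>"

lemma walk_DA: "range x \<subseteq> DA q \<Longrightarrow> walk x n \<in> DA q"
  by (induction n) (auto simp: id_DA simp del: o_apply intro!: DA_comp)

lemma range_shift_seq: "range x \<subseteq> A \<Longrightarrow> range (shift_seq n x) \<subseteq> A"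
  by auto

lemma walk_add: "walk x (n + k) = walk (shift_seq n x) k \<circ> walk x n"
  by (induction k) (simp_all add: o_assoc)

lemma limit_portrait_unique:
  "limit_portrait x v \<sigma> \<Longrightarrow> limit_portrait x v \<tau> \<Longrightarrow> \<sigma> = \<tau>"
  by (drule (1) eventually_conj) (auto dest: eventually_happens)

lemma final_config_eqI:
  assumes "v \<in> V" "limit_portrait x v \<sigma>"
  shows "final_config q x v = \<sigma>"
proof -
  have "(THE \<sigma>. limit_portrait x v \<sigma>) = \<sigma>"
  proof (rule the_equality)
    show "\<tau> = \<sigma>" if "limit_portrait x v \<tau>" for \<tau>
      using that assms(2) by (rule limit_portrait_unique)
  qed (rule assms(2))
  moreover have "\<exists>\<sigma>. limit_portrait x v \<sigma>" using assms(2) by blast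
  ultimately show ?thesis using assms(1) by (simp add: final_config_def Let_def)
qed

lemma final_config_no_limit:
  assumes "v \<in> V" "\<nexists>\<sigma>. limit_portrait x v \<sigma>"
  shows "final_config q x v = id"
  using assms by (auto simp: final_config_def Let_def)

lemma limit_portrait_shift:
  assumes "range x \<subseteq> DA q" "v \<in> V"
  shows "limit_portrait x v (\<sigma> \<circ> portrait q (walk x n) v) \<longleftrightarrow>
    limit_portrait (shift_seq n x) (walk x n v) \<sigma>"
proof -
  let ?\<tau> = "portrait q (walk x n) v"
  have A: "walk x n \<in> AffT" "walk (shift_seq n x) k \<in> AffT" for k
    using walk_DA[OF assms(1)] walk_DA[OF range_shift_seq[OF assms(1)]] DA_Aff by blast+
  have "?\<tau> permutes {..<q}" using portrait_Sym[OF A(1) assms(2)] by (simp add: Sym_def)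
  then have "surj ?\<tau>" by (rule permutes_surj)
  have cancel: "\<rho> \<circ> ?\<tau> = \<sigma> \<circ> ?\<tau> \<longleftrightarrow> \<rho> = \<sigma>" for \<rho>
  proof
    assume eq: "\<rho> \<circ> ?\<tau> = \<sigma> \<circ> ?\<tau>"
    show "\<rho> = \<sigma>"
    proof (rule ext)
      fix y obtain t where "y = ?\<tau> t" using \<open>surj ?\<tau>\<close> by (rule surjE)
      then show "\<rho> y = \<sigma> y" using fun_cong[OF eq, of t] by simp
    qed
  qed simp
  have "limit_portrait x v (\<sigma> \<circ> ?\<tau>) \<longleftrightarrow>
      (\<forall>\<^sub>F k in sequentially. portrait q (walk x (k + n)) v = \<sigma> \<circ> ?\<tau>)"
    by (rule eventually_sequentially_seg[symmetric])
  also have "\<dots> \<longleftrightarrow> limit_portrait (shift_seq n x) (walk x n v) \<sigma>"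
    using walk_add[of x n] cancel by (simp add: add.commute[of _ n] portrait_comp[OF A assms(2)])
  finally show ?thesis .
qed

lemma final_config_shift:
  assumes "range x \<subseteq> DA q" "v \<in> V" "portrait q (walk x n) v = id"
  shows "final_config q x v = final_config q (shift_seq n x) (walk x n v)"
proof -
  have eq: "limit_portrait x v \<sigma> \<longleftrightarrow> limit_portrait (shift_seq n x) (walk x n v) \<sigma>" for \<sigma>
    using limit_portrait_shift[OF assms(1,2), where \<sigma> = \<sigma> and n = n] assms(3) by simp
  have w: "walk x n v \<in> V" using assms walk_DA[of x n] DA_Aff by simp
  show ?thesis
  proof (cases "\<exists>\<sigma>. limit_portrait x v \<sigma>")
    case True
    then obtain \<sigma> where "limit_portrait x v \<sigma>" by blast
    then show ?thesis using final_config_eqI[OF assms(2)] final_config_eqI[OF w] eq by metis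
  next
    case False
    then show ?thesis using final_config_no_limit[OF assms(2)] final_config_no_limit[OF w] eq by metis
  qed
qed

definition trivial_beyond :: "int \<Rightarrow> int \<Rightarrow> (vertex \<Rightarrow> nat \<Rightarrow> nat) \<Rightarrow> bool" where
  "trivial_beyond s h \<gamma> \<longleftrightarrow> (\<forall>v\<in>V. h \<le> s * height v \<longrightarrow> \<gamma> v = id)"

definition eventually_trivial :: "int \<Rightarrow> (vertex \<Rightarrow> nat \<Rightarrow> nat) \<Rightarrow> bool" where
  "eventually_trivial s \<gamma> \<longleftrightarrow> (\<exists>h. trivial_beyond s h \<gamma>)"

lemma eventually_trivial_shift:
  assumes x: "range x \<subseteq> DA q" and s: "\<bar>s\<bar> = 1"
  shows "eventually_trivial s (final_config q x) \<longleftrightarrow>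
    eventually_trivial s (final_config q (shift_seq n x))"
proof -
  define w where "w = walk x n"
  have w: "w \<in> DA q" "w \<in> AffT" using walk_DA[OF x] DA_Aff by (auto simp: w_def)
  have ht: "s * height (w v) = s * height v + s * Phi w" if "v \<in> V" for v
    using Aff_height[OF q_pos w(2) that] by (simp add: height_def algebra_simps)
  have "finite ((\<lambda>v. s * height v) ` {v \<in> V. portrait q w v \<noteq> id})" (is "finite ?S")
    using w by (simp add: DA_def)
  then have "bdd_above ?S" by (rule bdd_above_finite)
  then obtain K where "\<And>y. y \<in> ?S \<Longrightarrow> y \<le> K" by (meson bdd_above.E)
  then have K: "\<And>v. v \<in> V \<Longrightarrow> portrait q w v \<noteq> id \<Longrightarrow> s * height v \<le> K"
    by blast
  have fin: "final_config q x v = final_config q (shift_seq n x) (w v)"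
    if "v \<in> V" "K < s * height v" for v
    using final_config_shift[OF x that(1), where n = n] K[OF that(1)] that(2) by (auto simp: w_def)
  show ?thesis
  proof
    assume "eventually_trivial s (final_config q x)"
    then obtain h where h: "trivial_beyond s h (final_config q x)" by (auto simp: eventually_trivial_def)
    have "trivial_beyond s (max h (K + 1) + s * Phi w) (final_config q (shift_seq n x))"
      unfolding trivial_beyond_def
    proof (intro ballI impI)
      fix u assume u: "u \<in> V" "max h (K + 1) + s * Phi w \<le> s * height u"
      define v where "v = Hilbert_Choice.inv w u"
      have wv: "w v = u" using Aff_inverses[OF q_pos w(2)] by (simp add: v_def)
      then have v: "v \<in> V" using u w(2) by (metis Aff_verts_iff)
      show "final_config q (shift_seq n x) u = id"
        using fin[OF v] ht[OF v] h u v wv by (auto simp: trivial_beyond_def)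
    qed
    then show "eventually_trivial s (final_config q (shift_seq n x))"
      by (auto simp: eventually_trivial_def)
  next
    assume "eventually_trivial s (final_config q (shift_seq n x))"
    then obtain h where h: "trivial_beyond s h (final_config q (shift_seq n x))"
      by (auto simp: eventually_trivial_def)
    have "trivial_beyond s (max (h - s * Phi w) (K + 1)) (final_config q x)"
      unfolding trivial_beyond_def
      using fin ht h w(2) by (auto simp: trivial_beyond_def)
    then show "eventually_trivial s (final_config q x)"
      by (auto simp: eventually_trivial_def)
  qed
qed

lemma limit_portrait_id:
  assumes x: "range x \<subseteq> DA q" and v: "v \<in> V" and id: "\<And>n. portrait q (x n) (walk x n v) = id"
  shows "limit_portrait x v id"
proof -
  have "portrait q (walk x n) v = id" for n
  proof (induction n)
    case 0
    have "portrait q id v = id" using portrait_unique[OF Aff_id v id_Sym] by simp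
    then show ?case unfolding right_walk.simps one_Aff .
  next
    case (Suc n)
    have "walk x n \<in> AffT" "x n \<in> AffT" using walk_DA[OF x] x DA_Aff by blast+
    from portrait_comp[OF this v] show ?case
      unfolding right_walk.simps mult_Aff Suc id[of n] by (simp only: comp_id)
  qed
  then show ?thesis by simp
qed

lemma limit_portrait_exists:
  assumes x: "range x \<subseteq> DA q" and v: "v \<in> V"
    and ev: "\<forall>\<^sub>F n in sequentially. portrait q (x n) (walk x n v) = id"
  shows "\<exists>\<sigma>\<in>Sym q. limit_portrait x v \<sigma>"
proof -
  obtain N where N: "\<And>n. n \<ge> N \<Longrightarrow> portrait q (x n) (walk x n v) = id"
    using ev by (auto simp: eventually_sequentially)
  have A: "walk x N \<in> AffT" using walk_DA[OF x] DA_Aff by blast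
  have "limit_portrait (shift_seq N x) (walk x N v) id"
  proof (rule limit_portrait_id[OF range_shift_seq[OF x]])
    show "walk x N v \<in> V" using v A by simp
    show "portrait q (x (N + n)) (walk (shift_seq N x) n (walk x N v)) = id" for n
      using N[of "N + n"] walk_add[of x N n] by (simp add: fun_eq_iff)
  qed
  then have "limit_portrait x v (portrait q (walk x N) v)"
    using limit_portrait_shift[OF x v, where \<sigma> = id and n = N] by simp
  then show ?thesis using portrait_Sym[OF A v] by blast
qed

end

section \<open>The law of the walk\<close>

locale tree_walk = regular_tree +
  fixes \<mu> :: "(vertex \<Rightarrow> vertex) pmf"
  assumes support_DA: "set_pmf \<mu> \<subseteq> DA q"
    and finite_support: "finite (set_pmf \<mu>)"
    and nondegenerate: "nondegenerate q \<mu>"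
begin

lemma countable_DA: "countable (DA q)"
proof -
  define f :: "(vertex \<Rightarrow> vertex) list \<Rightarrow> vertex \<Rightarrow> vertex" where "f xs = foldr (\<lambda>g h. h \<circ> g) xs id" for xs
  have app: "f (xs @ ys) = f ys \<circ> f xs" for xs ys
    unfolding f_def by (induction xs) (simp_all only: foldr.simps append.simps o_apply o_assoc id_apply comp_id)
  have "g \<in> f ` lists (set_pmf \<mu>)" if "g \<in> semigroup_generated (Aff q) (set_pmf \<mu>)" for g
    using that
  proof induction
    case (generator g)
    then have "f [g] = g" "[g] \<in> lists (set_pmf \<mu>)" by (auto simp: f_def)
    then show ?case by (metis imageI)
  next
    case (product g h)
    then obtain xs ys where "g = f xs" "h = f ys" "xs @ ys \<in> lists (set_pmf \<mu>)" by auto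
    then show ?case using app[of xs ys] by (metis imageI mult_Aff)
  qed
  then have "DA q \<subseteq> f ` lists (set_pmf \<mu>)"
    using nondegenerate by (auto simp: nondegenerate_def)
  then show ?thesis
    using finite_support countable_subset by (meson countable_finite countable_image countable_lists)
qed

definition step_law :: "(vertex \<Rightarrow> vertex) measure" where
  "step_law = restrict_space (measure_pmf \<mu>) (DA q)"

lemma space_step_law [simp]: "space step_law = DA q"
  by (simp add: step_law_def space_restrict_space)

lemma sets_step_law [measurable_cong]: "sets step_law = sets (count_space (DA q))"
  by (auto simp: step_law_def sets_restrict_space)

lemma prob_space_step_law: "prob_space step_law"
  unfolding step_law_def using support_DA
  by (intro prob_space_restrict_space measure_pmf.emeasure_eq_1_AE) (auto simp: AE_measure_pmf_iff)

abbreviation Pr :: "(nat \<Rightarrow> vertex \<Rightarrow> vertex) measure" where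
  "Pr \<equiv> increment_space q \<mu>"

lemma Pr_eq: "Pr = (\<Pi>\<^sub>M i\<in>UNIV. step_law)"
  by (simp add: increment_space_def step_law_def)

sublocale steps: sequence_space step_law
  unfolding sequence_space_def by (intro product_prob_spaceI prob_space_step_law)

sublocale prob_space Pr
  unfolding Pr_eq by (rule steps.prob_space_axioms)

lemma space_Pr: "x \<in> space Pr \<longleftrightarrow> range x \<subseteq> DA q"
  by (auto simp: Pr_eq space_PiM)

lemma Pr_step_DA: "x \<in> space Pr \<Longrightarrow> range x \<subseteq> DA q"
  by (simp add: space_Pr)

lemma measurable_coordinate [measurable]: "(\<lambda>x. x i) \<in> Pr \<rightarrow>\<^sub>M count_space (DA q)"
proof -
  have "(\<lambda>x. x i) \<in> Pr \<rightarrow>\<^sub>M step_law"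
    unfolding Pr_eq by measurable
  then show ?thesis unfolding measurable_cong_sets[OF refl sets_step_law] .
qed

lemma measurable_walk [measurable]: "(\<lambda>x. walk x n) \<in> Pr \<rightarrow>\<^sub>M count_space (DA q)"
proof (induction n)
  case 0
  show ?case unfolding right_walk.simps one_Aff by (rule measurable_const) (simp only: space_count_space id_DA)
next
  case (Suc n)
  have "(\<lambda>x. x n \<circ> g) \<in> Pr \<rightarrow>\<^sub>M count_space (DA q)" if "g \<in> DA q" for g
    by (rule measurable_compose[OF measurable_coordinate, of "\<lambda>h. h \<circ> g"])
      (use that in \<open>auto simp: DA_comp simp del: o_apply\<close>)
  from measurable_compose_countable'[OF this Suc countable_DA]
  show ?case by (simp only: right_walk.simps mult_Aff)
qed

lemma pred_walk: "Measurable.pred Pr (\<lambda>x. P (walk x n))"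
  by (rule measurable_compose[OF measurable_walk, of P]) simp

lemma sets_walk: "{x \<in> space Pr. P (walk x n)} \<in> sets Pr"
  by (rule predE[OF pred_walk])

lemma measurable_shift_seq [measurable]: "shift_seq n \<in> Pr \<rightarrow>\<^sub>M Pr"
  unfolding Pr_eq by (rule measurable_PiM_single') (auto simp: space_PiM)

lemma measurable_DA_countable:
  assumes "f \<in> M \<rightarrow>\<^sub>M count_space (DA q)" "\<And>g. g \<in> DA q \<Longrightarrow> Measurable.pred M (\<lambda>x. P g x)"
  shows "Measurable.pred M (\<lambda>x. P (f x) x)"
  by (rule measurable_compose_countable'[OF assms(2) assms(1) countable_DA])

lemma walk_cong: "(\<And>i. i < n \<Longrightarrow> x i = y i) \<Longrightarrow> walk x n = walk y n"
  by (induction n) auto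

lemma measurable_split:
  assumes "\<And>g. g \<in> DA q \<Longrightarrow> Q g \<in> sets Pr"
  shows "{x \<in> space Pr. shift_seq n x \<in> Q (walk x n)} \<in> sets Pr"
proof (rule predE, rule measurable_DA_countable[OF measurable_walk])
  show "Measurable.pred Pr (\<lambda>x. shift_seq n x \<in> Q g)" if "g \<in> DA q" for g
    using assms[OF that] measurable_shift_seq[of n] by (intro pred_sets2)
qed

lemma walk_split:
  assumes Q: "\<And>g. g \<in> DA q \<Longrightarrow> Q g \<in> sets Pr"
  shows "prob {x \<in> space Pr. shift_seq n x \<in> Q (walk x n)} = (\<integral>x. prob (Q (walk x n)) \<partial>Pr)"
proof -
  let ?A = "{x \<in> space Pr. shift_seq n x \<in> Q (walk x n)}"
  let ?c = "\<lambda>(x, y). comb_seq n x y"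
  have A: "?A \<in> sets Pr" using measurable_split Q by blast
  have c: "?c \<in> Pr \<Otimes>\<^sub>M Pr \<rightarrow>\<^sub>M Pr" unfolding Pr_eq by (rule measurable_comb_seq)
  have sec: "Pair x -` (?c -` ?A \<inter> space (Pr \<Otimes>\<^sub>M Pr)) = Q (walk x n)" if x: "x \<in> space Pr" for x
  proof -
    have "walk (comb_seq n x y) n = walk x n" for y by (rule walk_cong) (simp add: comb_seq_less)
    moreover have "(\<lambda>i. comb_seq n x y (n + i)) = y" for y by (simp add: comb_seq_def)
    moreover have "Q (walk x n) \<subseteq> space Pr"
      using Q[OF walk_DA[OF Pr_step_DA[OF x]]] sets.sets_into_space by blast
    moreover have "comb_seq n x y \<in> space Pr" if "y \<in> space Pr" for y
      using x that by (auto simp: space_Pr comb_seq_def image_subset_iff)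
    ultimately show ?thesis using x by (auto simp: space_pair_measure)
  qed
  have meas: "(\<lambda>x. prob (Q (walk x n))) \<in> borel_measurable Pr"
    by (rule measurable_compose[OF measurable_walk, of "\<lambda>g. prob (Q g)"]) simp
  have "emeasure Pr ?A = emeasure (distr (Pr \<Otimes>\<^sub>M Pr) Pr ?c) ?A"
    unfolding Pr_eq by (subst steps.PiM_comb_seq) simp
  also have "\<dots> = emeasure (Pr \<Otimes>\<^sub>M Pr) (?c -` ?A \<inter> space (Pr \<Otimes>\<^sub>M Pr))"
    by (rule emeasure_distr[OF c A])
  also have "\<dots> = (\<integral>\<^sup>+x. emeasure Pr (Q (walk x n)) \<partial>Pr)"
    using emeasure_pair_measure_alt[OF measurable_sets[OF c A]] sec by (simp cong: nn_integral_cong)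
  also have "\<dots> = (\<integral>\<^sup>+x. ennreal (prob (Q (walk x n))) \<partial>Pr)"
    by (simp add: emeasure_eq_measure)
  also have "\<dots> = ennreal (\<integral>x. prob (Q (walk x n)) \<partial>Pr)"
    by (intro nn_integral_eq_integral integrable_const_bound[where B = 1] meas) auto
  finally show ?thesis by (simp add: emeasure_eq_measure)
qed

lemma walk_independent:
  assumes g: "g \<in> DA q" and A: "A \<in> sets Pr"
  shows "prob {x \<in> space Pr. walk x n = g \<and> shift_seq n x \<in> A} =
    prob {x \<in> space Pr. walk x n = g} * prob A"
proof -
  let ?Q = "\<lambda>h. if h = g then A else {}"
  have "{x \<in> space Pr. walk x n = g \<and> shift_seq n x \<in> A} =
      {x \<in> space Pr. shift_seq n x \<in> ?Q (walk x n)}" by auto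
  also have "prob \<dots> = (\<integral>x. prob (?Q (walk x n)) \<partial>Pr)"
    by (rule walk_split) (use A in auto)
  also have "\<dots> = (\<integral>x. indicator {x \<in> space Pr. walk x n = g} x * prob A \<partial>Pr)"
    by (intro Bochner_Integration.integral_cong) (auto simp: indicator_def)
  also have "\<dots> = prob {x \<in> space Pr. walk x n = g} * prob A"
    by (subst integral_mult_left_zero) (simp add: Int_def conj_commute)
  finally show ?thesis .
qed

lemma distr_coordinate: "distr Pr step_law (\<lambda>x. x i) = step_law"
  unfolding Pr_eq by (rule distr_PiM_component) (auto intro: prob_space_step_law)

lemma expectation_coordinate:
  fixes f :: "(vertex \<Rightarrow> vertex) \<Rightarrow> real"
  shows "(\<integral>x. f (x i) \<partial>Pr) = (\<Sum>g\<in>set_pmf \<mu>. pmf \<mu> g * f g)"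
proof -
  have f: "f \<in> borel_measurable step_law"
    unfolding measurable_cong_sets[OF sets_step_law refl] by simp
  have c: "(\<lambda>x. x i) \<in> Pr \<rightarrow>\<^sub>M step_law"
    unfolding measurable_cong_sets[OF refl sets_step_law] by (rule measurable_coordinate)
  have "(\<integral>x. f (x i) \<partial>Pr) = (\<integral>g. f g \<partial>step_law)"
    using integral_distr[OF c f] by (simp add: distr_coordinate)
  also have "\<dots> = (\<integral>g. f g \<partial>measure_pmf \<mu>)"
    unfolding step_law_def
    by (subst integral_restrict_space)
      (use support_DA in \<open>auto intro!: integral_cong_AE simp: AE_measure_pmf_iff subset_iff\<close>)
  also have "\<dots> = (\<Sum>g\<in>set_pmf \<mu>. pmf \<mu> g * f g)"
    by (subst integral_measure_pmf[OF finite_support]) (auto simp: mult.commute)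
  finally show ?thesis .
qed

lemma AE_coordinate: "AE x in Pr. x i \<in> set_pmf \<mu>"
proof -
  have "AE g in step_law. g \<in> set_pmf \<mu>"
    unfolding step_law_def by (subst AE_restrict_space_iff) (auto simp: AE_measure_pmf_iff)
  then have "AE g in distr Pr step_law (\<lambda>x. x i). g \<in> set_pmf \<mu>"
    by (simp only: distr_coordinate)
  moreover have "(\<lambda>x. x i) \<in> Pr \<rightarrow>\<^sub>M step_law"
    unfolding measurable_cong_sets[OF refl sets_step_law] by (rule measurable_coordinate)
  ultimately show ?thesis using AE_distrD by blast
qed

lemma walk_reaches:
  assumes "g \<in> DA q"
  obtains n where "prob {x \<in> space Pr. walk x n = g} > 0"
proof -
  have "g \<in> semigroup_generated (Aff q) (set_pmf \<mu>)"
    using assms nondegenerate by (simp add: nondegenerate_def)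
  then have "\<exists>n. prob {x \<in> space Pr. walk x n = g} > 0"
  proof induction
    case (generator g)
    have "prob {x \<in> space Pr. walk x 1 = g} = (\<integral>x. indicator {x \<in> space Pr. walk x 1 = g} x \<partial>Pr)"
      by (subst Bochner_Integration.integral_indicator) (rule arg_cong[where f = prob], blast)
    also have "\<dots> = (\<integral>x. of_bool (x 0 = g) \<partial>Pr)"
      by (intro Bochner_Integration.integral_cong) (auto simp: indicator_def)
    also have "\<dots> = pmf \<mu> g"
      using generator finite_support by (subst expectation_coordinate) (simp add: of_bool_def if_distrib sum.delta' cong: if_cong)
    finally show ?case using generator by (auto simp: pmf_positive_iff intro!: exI[of _ 1])
  next
    case (product g h)
    then obtain n k where nk: "prob {x \<in> space Pr. walk x n = g} > 0"
        "prob {x \<in> space Pr. walk x k = h} > 0" by auto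
    have gh: "g \<in> DA q" "h \<in> DA q"
      using product nondegenerate by (auto simp: nondegenerate_def)
    have "0 < prob {x \<in> space Pr. walk x n = g} * prob {x \<in> space Pr. walk x k = h}" using nk by simp
    also have "\<dots> = prob {x \<in> space Pr. walk x n = g \<and> shift_seq n x \<in> {x \<in> space Pr. walk x k = h}}"
      by (rule walk_independent[symmetric]) (use gh sets_walk in auto)
    also have "\<dots> \<le> prob {x \<in> space Pr. walk x (n + k) = g \<otimes>\<^bsub>Aff q\<^esub> h}"
      by (intro finite_measure_mono sets_walk) (auto simp: walk_add)
    finally show ?case by blast
  qed
  then show ?thesis using that by blast
qed

lemma measurable_limit_portrait [measurable]:
  assumes "v \<in> V" shows "Measurable.pred Pr (\<lambda>x. limit_portrait x v \<sigma>)"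
proof -
  have "Measurable.pred Pr (\<lambda>x. portrait q (walk x n) v = \<sigma>)" for n
    by (rule pred_walk)
  then show ?thesis unfolding eventually_sequentially by measurable
qed

lemma final_config_Sym:
  assumes "x \<in> space Pr" "v \<in> V" shows "final_config q x v \<in> Sym q"
proof (cases "\<exists>\<sigma>. limit_portrait x v \<sigma>")
  case True
  then obtain \<sigma> where \<sigma>: "limit_portrait x v \<sigma>" by blast
  then obtain n where "portrait q (walk x n) v = \<sigma>" by (auto dest: eventually_happens)
  moreover have "walk x n \<in> AffT" using walk_DA[OF Pr_step_DA[OF assms(1)]] DA_Aff by blast
  ultimately show ?thesis
    using final_config_eqI[OF assms(2) \<sigma>] portrait_Sym[of "walk x n" v] assms(2) by simp
next
  case False
  then show ?thesis using final_config_no_limit[OF assms(2)] id_Sym by simp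
qed

lemma final_config_eq_iff:
  assumes "x \<in> space Pr" "v \<in> V"
  shows "final_config q x v = \<sigma> \<longleftrightarrow>
    limit_portrait x v \<sigma> \<or> \<sigma> = id \<and> (\<forall>\<tau>\<in>Sym q. \<not> limit_portrait x v \<tau>)"
proof (cases "\<exists>\<sigma>. limit_portrait x v \<sigma>")
  case True
  then obtain \<tau> where \<tau>: "limit_portrait x v \<tau>" by blast
  note eq = final_config_eqI[OF assms(2) \<tau>]
  then have "\<tau> \<in> Sym q" using final_config_Sym[OF assms] by simp
  then show ?thesis using eq \<tau> limit_portrait_unique[OF \<tau>] by blast
next
  case False
  then show ?thesis using final_config_no_limit[OF assms(2)] by (metis (no_types))
qed

lemma measurable_final_config [measurable]: "final_config q \<in> Pr \<rightarrow>\<^sub>M config_space q"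
  unfolding config_space_def
proof (rule measurable_PiM_single')
  show "final_config q \<in> space Pr \<rightarrow> (\<Pi>\<^sub>E v\<in>V. space (count_space (Sym q)))"
    using final_config_Sym by (auto simp: PiE_iff final_config_def)
next
  fix v assume v: "v \<in> V"
  show "(\<lambda>x. final_config q x v) \<in> Pr \<rightarrow>\<^sub>M count_space (Sym q)"
  proof (rule measurable_count_space_eq2[THEN iffD2, OF finite_Sym], intro conjI ballI)
    show "(\<lambda>x. final_config q x v) -` {\<sigma>} \<inter> space Pr \<in> sets Pr" for \<sigma>
    proof -
      have "(\<lambda>x. final_config q x v) -` {\<sigma>} \<inter> space Pr = {x \<in> space Pr.
          limit_portrait x v \<sigma> \<or> \<sigma> = id \<and> (\<forall>\<tau>\<in>Sym q. \<not> limit_portrait x v \<tau>)}"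
        using final_config_eq_iff[OF _ v] by auto
      also have "\<dots> \<in> sets Pr" using v finite_Sym[THEN countable_finite] by measurable
      finally show ?thesis .
    qed
  qed (use final_config_Sym v in auto)
qed

section \<open>Transience\<close>

text \<open>
  The truncated Green function at \<open>(b, b)\<close> dominates its values at \<open>(a, b)\<close> and \<open>(b, a)\<close>, the latter
  because the counting measure on vertices is invariant. The values at \<open>(v, b)\<close> for the \<open>q\<close> children
  \<open>v\<close> of \<open>b\<close> sum to the value at \<open>(b, parent b)\<close>, yet each differs from the value at \<open>(b, b)\<close> by a
  bounded amount. Hence \<open>q\<close> times the value at \<open>(b, b)\<close> exceeds that value by a bounded amount.
\<close>

definition trans_op :: "(vertex \<Rightarrow> real) \<Rightarrow> vertex \<Rightarrow> real" where
  "trans_op f a = (\<Sum>g\<in>set_pmf \<mu>. pmf \<mu> g * f (g a))"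

abbreviation trans_prob :: "nat \<Rightarrow> vertex \<Rightarrow> vertex \<Rightarrow> real" where
  "trans_prob n a b \<equiv> (trans_op ^^ n) (indicator {b}) a"

definition green :: "nat \<Rightarrow> vertex \<Rightarrow> vertex \<Rightarrow> real" where
  "green N a b = (\<Sum>n\<le>N. trans_prob n a b)"

lemma sum_pmf [simp]: "(\<Sum>g\<in>set_pmf \<mu>. pmf \<mu> g) = 1"
  using finite_support by (intro sum_pmf_eq_1) auto

lemma support_Aff: "g \<in> set_pmf \<mu> \<Longrightarrow> g \<in> AffT"
  using support_DA DA_Aff by blast

lemma trans_op_sum:
  "trans_op (\<lambda>z. \<Sum>i\<in>I. c i * f i z) a = (\<Sum>i\<in>I. c i * trans_op (f i) a)"
  unfolding trans_op_def sum_distrib_left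
  by (subst sum.swap) (simp add: ac_simps)

lemma trans_pow_sum:
  "(trans_op ^^ n) (\<lambda>z. \<Sum>i\<in>I. c i * f i z) a = (\<Sum>i\<in>I. c i * (trans_op ^^ n) (f i) a)"
proof (induction n arbitrary: a)
  case (Suc n)
  have "(trans_op ^^ n) (\<lambda>z. \<Sum>i\<in>I. c i * f i z) = (\<lambda>a. \<Sum>i\<in>I. c i * (trans_op ^^ n) (f i) a)"
    using Suc by (rule ext)
  then show ?case by (simp add: trans_op_sum)
qed simp

lemma trans_pow_Suc:
  "(trans_op ^^ Suc n) f a = (\<Sum>g\<in>set_pmf \<mu>. pmf \<mu> g * (trans_op ^^ n) f (g a))"
  unfolding funpow.simps o_apply trans_op_def[of "(trans_op ^^ n) f"] ..

lemma trans_pow_mono: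
  assumes "\<And>z. f z \<le> h z" shows "(trans_op ^^ n) f a \<le> (trans_op ^^ n) h a"
proof (induction n arbitrary: a)
  case (Suc n)
  then show ?case unfolding trans_pow_Suc by (intro sum_mono mult_left_mono) auto
qed (use assms in simp)

lemma trans_pow_const: "(trans_op ^^ n) (\<lambda>_. c) a = c"
proof (induction n arbitrary: a)
  case (Suc n)
  then show ?case unfolding trans_pow_Suc by (simp flip: sum_distrib_right)
qed simp

lemma trans_prob_nonneg: "0 \<le> trans_prob n a b"
  using trans_pow_mono[of "\<lambda>_. 0" "indicator {b}" n a] by (simp add: trans_pow_const)

lemma trans_prob_le_1: "trans_prob n a b \<le> 1"
  using trans_pow_mono[of "indicator {b}" "\<lambda>_. 1" n a] by (simp add: trans_pow_const indicator_def)

lemma green_nonneg: "0 \<le> green N a b"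
  unfolding green_def by (intro sum_nonneg trans_prob_nonneg)

lemma green_mono: "green N a b \<le> green (Suc N) a b"
  using trans_prob_nonneg[of "Suc N" b a] by (simp add: green_def)

lemma green_first_step:
  "green (Suc N) a b = indicator {b} a + (\<Sum>g\<in>set_pmf \<mu>. pmf \<mu> g * green N (g a) b)"
proof -
  have "(\<Sum>n\<le>N. trans_prob (Suc n) a b) = (\<Sum>g\<in>set_pmf \<mu>. pmf \<mu> g * green N (g a) b)"
    unfolding green_def sum_distrib_left trans_pow_Suc by (rule sum.swap)
  then show ?thesis unfolding green_def by (subst sum.atMost_Suc_shift) simp
qed

lemma trans_prob_last_step:
  "trans_prob (Suc n) a b = (\<Sum>g\<in>set_pmf \<mu>. pmf \<mu> g * trans_prob n a (Hilbert_Choice.inv g b))"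
proof -
  have "trans_op (indicator {b}) = (\<lambda>z. \<Sum>g\<in>set_pmf \<mu>. pmf \<mu> g * indicator {Hilbert_Choice.inv g b} z)"
  proof
    fix z
    have "g z = b \<longleftrightarrow> z = Hilbert_Choice.inv g b" if "g \<in> set_pmf \<mu>" for g
      using Aff_inverses[OF q_pos support_Aff[OF that]] by metis
    then show "trans_op (indicator {b}) z =
        (\<Sum>g\<in>set_pmf \<mu>. pmf \<mu> g * indicator {Hilbert_Choice.inv g b} z)"
      by (auto simp: trans_op_def indicator_def intro!: sum.cong)
  qed
  then show ?thesis
    unfolding funpow_Suc_right o_apply by (simp only: trans_pow_sum)
qed

lemma green_last_step:
  "green (Suc N) a b = indicator {b} a +
    (\<Sum>g\<in>set_pmf \<mu>. pmf \<mu> g * green N a (Hilbert_Choice.inv g b))"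
proof -
  have "(\<Sum>n\<le>N. trans_prob (Suc n) a b) =
      (\<Sum>g\<in>set_pmf \<mu>. pmf \<mu> g * green N a (Hilbert_Choice.inv g b))"
    unfolding green_def sum_distrib_left trans_prob_last_step by (rule sum.swap)
  then show ?thesis unfolding green_def by (subst sum.atMost_Suc_shift) simp
qed

lemma average_le:
  assumes "\<And>g. g \<in> set_pmf \<mu> \<Longrightarrow> f g \<le> c" shows "(\<Sum>g\<in>set_pmf \<mu>. pmf \<mu> g * f g) \<le> c"
proof -
  have "(\<Sum>g\<in>set_pmf \<mu>. pmf \<mu> g * f g) \<le> (\<Sum>g\<in>set_pmf \<mu>. pmf \<mu> g * c)"
    using assms by (intro sum_mono mult_left_mono) auto
  then show ?thesis by (simp flip: sum_distrib_right)
qed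

lemma green_le_diagonal_start: "green N a b \<le> green N b b"
proof (induction N arbitrary: a)
  case 0
  then show ?case by (simp add: green_def indicator_def)
next
  case (Suc N)
  show ?case
  proof (cases "a = b")
    case False
    have "green (Suc N) a b \<le> green N b b"
      using False Suc by (simp add: green_first_step average_le)
    then show ?thesis using green_mono[of N b b] by simp
  qed simp
qed

lemma green_le_diagonal_end: "green N b a \<le> green N b b"
proof (induction N arbitrary: a)
  case 0
  then show ?case by (simp add: green_def indicator_def)
next
  case (Suc N)
  show ?case
  proof (cases "a = b")
    case False
    have "green (Suc N) b a \<le> green N b b"
      using False Suc by (simp add: green_last_step average_le)
    then show ?thesis using green_mono[of N b b] by simp
  qed simp
qed

text \<open>Some child of \<open>c\<close> is mapped to \<open>b\<close> iff \<open>c\<close> is mapped to the parent of \<open>b\<close>.\<close>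

lemma trans_prob_children:
  assumes "b \<in> V" "c \<in> V"
  shows "(\<Sum>t<q. trans_prob n (child c t) b) = trans_prob n c (parent b)"
  using assms(2)
proof (induction n arbitrary: c)
  case 0
  have "child c t = b \<longleftrightarrow> c = parent b \<and> t = snd b (fst b)" for t
    using parent_child[OF 0, of t] child_last[OF assms(1)] by (metis child_inject)
  then show ?case
    using last_less[OF assms(1)] by (auto simp: indicator_def sum.delta')
next
  case (Suc n)
  have "(\<Sum>t<q. trans_prob n (g (child c t)) b) = trans_prob n (g c) (parent b)"
    if g: "g \<in> set_pmf \<mu>" for g
  proof -
    note A = support_Aff[OF g]
    have "(\<Sum>t<q. trans_prob n (g (child c t)) b) =
        (\<Sum>t<q. trans_prob n (child (g c) (portrait q g c t)) b)"
      using portrait_child[OF A Suc.prems] by simp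
    also have "\<dots> = (\<Sum>t<q. trans_prob n (child (g c) t) b)"
      using portrait_Sym[OF A Suc.prems]
      by (intro sum.reindex_bij_betw[where h = "portrait q g c"] permutes_imp_bij) (simp add: Sym_def)
    finally show ?thesis using Suc.IH[of "g c"] A Suc.prems by simp
  qed
  then have "(\<Sum>g\<in>set_pmf \<mu>. pmf \<mu> g * (\<Sum>t<q. trans_prob n (g (child c t)) b)) =
      trans_prob (Suc n) c (parent b)"
    unfolding trans_pow_Suc by (intro sum.cong) auto
  then show ?case
    unfolding sum_distrib_left trans_pow_Suc[of n _ "child _ _"] by (subst (asm) sum.swap)
qed

lemma prob_walk_eq_trans_prob: "prob {x \<in> space Pr. walk x n a = b} = trans_prob n a b"
proof (induction n arbitrary: a)
  case 0
  show ?case by (simp add: prob_space indicator_def)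
next
  case (Suc n)
  let ?Q = "\<lambda>g. {y \<in> space Pr. walk y n (g a) = b}"
  have "{x \<in> space Pr. walk x (Suc n) a = b} = {x \<in> space Pr. shift_seq 1 x \<in> ?Q (walk x 1)}"
    using walk_add[of _ 1 n] by (auto simp: space_Pr)
  also have "prob \<dots> = (\<integral>x. prob (?Q (walk x 1)) \<partial>Pr)"
    by (rule walk_split) (rule sets_walk)
  also have "\<dots> = (\<integral>x. trans_prob n (x 0 a) b \<partial>Pr)"
    by (simp add: Suc)
  also have "\<dots> = trans_prob (Suc n) a b"
    by (subst expectation_coordinate) (rule trans_pow_Suc[symmetric])
  finally show ?case .
qed

lemma green_difference_bounded:
  assumes "b \<in> V" "t < q"
  obtains C where "\<And>N. green N b b - green N (child b t) b \<le> C"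
proof -
  let ?v = "child b t"
  obtain g where g: "g \<in> DA q" "g b = ?v" using DA_child[OF assms] .
  obtain n where n: "prob {x \<in> space Pr. walk x n = g} > 0" using walk_reaches[OF g(1)] .
  define p where "p = trans_prob n b ?v"
  have "prob {x \<in> space Pr. walk x n = g} \<le> p"
    unfolding p_def prob_walk_eq_trans_prob[symmetric]
    by (intro finite_measure_mono sets_walk) (use g in auto)
  then have p: "p > 0" using n by simp
  have "green N b b - green N ?v b \<le> real n / p" for N
  proof -
    let ?D = "green N b b - green N ?v b"
    have "(\<Sum>k\<le>N. trans_prob k b b) \<le> (\<Sum>k\<in>{..<n} \<union> {n..n + N}. trans_prob k b b)"
      by (intro sum_mono2) (auto simp: trans_prob_nonneg)
    also have "\<dots> = (\<Sum>k<n. trans_prob k b b) + (\<Sum>k\<in>{n..n + N}. trans_prob k b b)"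
      by (intro sum.union_disjoint) auto
    also have "(\<Sum>k<n. trans_prob k b b) \<le> real n"
      using sum_bounded_above[of "{..<n}" "\<lambda>k. trans_prob k b b" 1] trans_prob_le_1 by simp
    also have "(\<Sum>k\<in>{n..n + N}. trans_prob k b b) = (\<Sum>k\<le>N. trans_prob (n + k) b b)"
      by (intro sum.reindex_bij_witness[of _ "\<lambda>k. n + k" "\<lambda>k. k - n"]) auto
    also have "\<dots> = (trans_op ^^ n) (\<lambda>z. green N z b) b"
      using trans_pow_sum[of n "\<lambda>_. 1" "\<lambda>k z. trans_prob k z b" "{..N}" b]
      by (simp add: green_def funpow_add)
    also have "\<dots> \<le> (trans_op ^^ n) (\<lambda>z. \<Sum>i\<in>{0,1::nat}. (if i = 0 then 1 else - ?D) *
        (if i = 0 then green N b b else indicator {?v} z)) b"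
      by (intro trans_pow_mono) (use green_le_diagonal_start in \<open>auto simp: indicator_def\<close>)
    also have "\<dots> = green N b b - ?D * p"
      by (subst trans_pow_sum) (simp add: trans_pow_const p_def algebra_simps)
    finally have "?D * p \<le> real n" by (simp add: green_def)
    then show ?thesis using p by (simp add: field_simps)
  qed
  then show ?thesis by (rule that)
qed

lemma green_bounded:
  assumes b: "b \<in> V"
  obtains C where "\<And>N a. green N a b \<le> C"
proof -
  obtain C where C: "\<And>t N. t < q \<Longrightarrow> green N b b - green N (child b t) b \<le> C t"
  proof -
    have "\<forall>t\<in>{..<q}. \<exists>C. \<forall>N. green N b b - green N (child b t) b \<le> C"
      using green_difference_bounded[OF b] by (metis lessThan_iff)
    from bchoice[OF this] show ?thesis using that by auto
  qed
  have "green N b b \<le> (\<Sum>t<q. C t)" for N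
  proof -
    have "real q * green N b b - (\<Sum>t<q. green N (child b t) b) \<le> (\<Sum>t<q. C t)"
      using sum_mono[of "{..<q}" "\<lambda>t. green N b b - green N (child b t) b" C] C
      by (simp add: sum_subtractf)
    moreover have "(\<Sum>t<q. green N (child b t) b) = green N b (parent b)"
      unfolding green_def by (subst sum.swap) (simp add: trans_prob_children[OF b b])
    moreover have "2 * green N b b \<le> real q * green N b b"
      using q_ge_2 green_nonneg by (intro mult_right_mono) auto
    ultimately show ?thesis using green_le_diagonal_end[of N b "parent b"] by linarith
  qed
  then show ?thesis using that green_le_diagonal_start order_trans by blast
qed

lemma AE_walk_leaves:
  assumes b: "b \<in> V"
  shows "AE x in Pr. \<forall>\<^sub>F n in sequentially. walk x n a \<noteq> b"
proof -
  obtain C where C: "\<And>N. green N a b \<le> C" using green_bounded[OF b] by metis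
  have "summable (\<lambda>n. trans_prob n a b)"
  proof (rule summableI_nonneg_bounded)
    show "(\<Sum>n<N. trans_prob n a b) \<le> C" for N
    proof -
      have "(\<Sum>n<N. trans_prob n a b) \<le> green N a b"
        unfolding green_def by (intro sum_mono2) (auto simp: trans_prob_nonneg)
      then show ?thesis using C[of N] by simp
    qed
  qed (rule trans_prob_nonneg)
  then have "AE x in Pr. \<forall>\<^sub>F n in sequentially. x \<in> space Pr - {x \<in> space Pr. walk x n a = b}"
    by (intro borel_cantelli_AE1 sets_walk)
      (simp_all add: prob_walk_eq_trans_prob emeasure_eq_measure)
  then show ?thesis by (rule AE_mp) (auto elim: eventually_mono)
qed

lemma finite_support_portraits: "finite (\<Union>g\<in>set_pmf \<mu>. {v \<in> V. portrait q g v \<noteq> id})"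
  using finite_support support_DA by (auto simp: DA_def)

lemma AE_limit_portrait:
  assumes v: "v \<in> V" shows "AE x in Pr. \<exists>\<sigma>\<in>Sym q. limit_portrait x v \<sigma>"
proof -
  let ?B = "\<Union>g\<in>set_pmf \<mu>. {v \<in> V. portrait q g v \<noteq> id}"
  have "AE x in Pr. \<forall>b\<in>?B. \<forall>\<^sub>F n in sequentially. walk x n v \<noteq> b"
    by (intro AE_finite_allI finite_support_portraits AE_walk_leaves) auto
  moreover have "AE x in Pr. \<forall>i. x i \<in> set_pmf \<mu>"
    unfolding AE_all_countable using AE_coordinate by blast
  moreover have "AE x in Pr. x \<in> space Pr" by simp
  ultimately show ?thesis
  proof eventually_elim
    case (elim x)
    have x: "range x \<subseteq> DA q" using elim by (simp add: space_Pr)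
    have "\<forall>\<^sub>F n in sequentially. \<forall>b\<in>?B. walk x n v \<noteq> b"
      using elim(1) by (intro eventually_ball_finite finite_support_portraits)
    then have "\<forall>\<^sub>F n in sequentially. portrait q (x n) (walk x n v) = id"
    proof (rule eventually_mono)
      fix n assume "\<forall>b\<in>?B. walk x n v \<noteq> b"
      moreover have "walk x n v \<in> V" using walk_DA[OF x, of n] DA_Aff v by simp
      ultimately show "portrait q (x n) (walk x n v) = id" using elim(2) by blast
    qed
    then show ?case by (rule limit_portrait_exists[OF x v])
  qed
qed

end

section \<open>Heights along the walk\<close>

lemma std_normal_cdf_pos: "cdf std_normal_distribution x > 0"
proof -
  interpret N: real_distribution std_normal_distribution by (rule real_dist_normal_dist)
  have "emeasure std_normal_distribution {..x} \<noteq> 0"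
  proof
    assume "emeasure std_normal_distribution {..x} = 0"
    then have "{..x} \<in> null_sets std_normal_distribution" by (auto simp: null_sets_def)
    then have "AE y in lborel. y \<in> {..x} \<longrightarrow> ennreal (std_normal_density y) = 0"
      by (subst (asm) null_sets_density_iff) auto
    then have "AE y in lborel. y \<notin> {..x}"
    proof eventually_elim
      case (elim y)
      have "std_normal_density y > 0" by (rule normal_density_pos) simp
      then show ?case using elim by auto
    qed
    then have "emeasure lborel {..x} = 0"
      by (subst (asm) AE_iff_null_sets[symmetric]) (auto simp: null_sets_def)
    moreover have "emeasure lborel {x - 1..x} \<le> emeasure lborel {..x}"
      by (intro emeasure_mono) auto
    ultimately show False by simp
  qed
  then show ?thesis
    by (simp add: cdf_def N.emeasure_eq_measure zero_less_measure_iff)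
qed

lemma std_normal_cdf_isCont: "isCont (cdf std_normal_distribution) x"
proof -
  interpret N: real_distribution std_normal_distribution by (rule real_dist_normal_dist)
  have "emeasure std_normal_distribution {x} = 0"
    by (subst emeasure_density) (auto simp: nn_integral_null_set)
  then show ?thesis by (simp add: N.isCont_cdf measure_def)
qed

context tree_walk
begin

definition mean_height :: real where
  "mean_height = (\<Sum>g\<in>set_pmf \<mu>. pmf \<mu> g * real_of_int (Phi g))"

lemma drift_reflected: "drift (reflected (Aff q) \<mu>) = - mean_height"
proof -
  have "drift (reflected (Aff q) \<mu>) = measure_pmf.expectation \<mu> (\<lambda>g. real_of_int (Phi (inv\<^bsub>Aff q\<^esub> g)))"
    by (simp add: drift_def reflected_def)
  also have "\<dots> = (\<Sum>g\<in>set_pmf \<mu>. pmf \<mu> g * real_of_int (Phi (inv\<^bsub>Aff q\<^esub> g)))"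
    by (subst integral_measure_pmf[OF finite_support]) (auto simp: mult.commute)
  also have "\<dots> = (\<Sum>g\<in>set_pmf \<mu>. - (pmf \<mu> g * real_of_int (Phi g)))"
    by (intro sum.cong) (auto simp: Phi_inv[OF q_pos support_Aff])
  finally show ?thesis by (simp add: mean_height_def sum_negf)
qed

lemma Phi_walk: "range x \<subseteq> DA q \<Longrightarrow> Phi (walk x n) = (\<Sum>i<n. Phi (x i))"
proof (induction n)
  case (Suc n)
  have "walk x n \<in> AffT" "x n \<in> AffT" using walk_DA Suc.prems DA_Aff by blast+
  from Phi_comp[OF q_pos this] show ?case using Suc by (simp del: o_apply)
qed (simp add: id_def[symmetric] del: id_apply)

lemma indep_coordinates: "indep_vars (\<lambda>_. step_law) (\<lambda>i x. x i) UNIV"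
proof (subst indep_vars_iff_distr_eq_PiM')
  show "random_variable step_law (\<lambda>x. x i)" for i
    unfolding measurable_cong_sets[OF refl sets_step_law] by (rule measurable_coordinate)
  have "distr Pr (\<Pi>\<^sub>M i\<in>UNIV. step_law) (\<lambda>x. \<lambda>i\<in>UNIV. x i) = distr Pr Pr (\<lambda>x. x)"
    by (intro distr_cong) (simp_all add: Pr_eq restrict_def)
  also have "\<dots> = (\<Pi>\<^sub>M i\<in>UNIV. step_law)" by (simp add: distr_id2 Pr_eq)
  finally show "distr Pr (\<Pi>\<^sub>M i\<in>UNIV. step_law) (\<lambda>x. \<lambda>i\<in>UNIV. x i) =
      (\<Pi>\<^sub>M i\<in>UNIV. distr Pr step_law (\<lambda>x. x i))"
    by (simp add: distr_coordinate)
qed simp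

lemma indep_increments:
  fixes f :: "(vertex \<Rightarrow> vertex) \<Rightarrow> real"
  shows "indep_vars (\<lambda>_. borel) (\<lambda>i x. f (x i)) I"
proof -
  have "f \<in> borel_measurable step_law"
    unfolding measurable_cong_sets[OF sets_step_law refl] by simp
  from indep_vars_compose2[OF indep_coordinates, of "\<lambda>_. f", OF this]
  show ?thesis by (rule indep_vars_subset) simp
qed

lemma sum_Phi:
  fixes s :: int
  assumes "x \<in> space Pr"
  shows "(\<Sum>i<n. real_of_int (s * Phi (x i))) = real_of_int (s * Phi (walk x n))"
  using assms by (simp add: Phi_walk space_Pr sum_distrib_left)

lemma AE_eventually_height_pos:
  fixes s :: int
  assumes pos: "s * mean_height > 0"
  shows "AE x in Pr. \<forall>\<^sub>F n in sequentially. s * Phi (walk x n) > 0"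
proof -
  define f where "f g = real_of_int (s * Phi g)" for g
  define m where "m = s * mean_height"
  obtain K where K: "K > 0" "\<And>g. g \<in> set_pmf \<mu> \<Longrightarrow> \<bar>f g\<bar> \<le> K"
  proof -
    have "bdd_above ((\<lambda>g. \<bar>f g\<bar>) ` set_pmf \<mu>)" using finite_support by (intro bdd_above_finite) auto
    then obtain K where "\<And>y. y \<in> (\<lambda>g. \<bar>f g\<bar>) ` set_pmf \<mu> \<Longrightarrow> y \<le> K" by (meson bdd_above.E)
    then show ?thesis using that[of "max K 1"] by fastforce
  qed
  have mean: "expectation (\<lambda>x. f (x i)) = m" for i
    by (subst expectation_coordinate) (simp add: m_def f_def mean_height_def sum_distrib_left ac_simps)
  define c where "c = exp (- (m\<^sup>2 / (2 * K\<^sup>2)))"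
  have c: "0 \<le> c" "c < 1" using pos K by (auto simp: c_def m_def intro!: divide_pos_pos)
  let ?A = "\<lambda>n. {x \<in> space Pr. s * Phi (walk x n) \<le> 0}"
  have bound: "prob (?A n) \<le> c ^ n" for n
  proof (cases "n = 0")
    case False
    interpret H: Hoeffding_ineq Pr "{..<n}" "\<lambda>i x. f (x i)" "\<lambda>_. - K" "\<lambda>_. K" "\<Sum>i<n. expectation (\<lambda>x. f (x i))"
    proof unfold_locales
      show "AE x in Pr. f (x i) \<in> {- K..K}" for i
        using AE_coordinate[of i] by eventually_elim (use K in \<open>auto simp: abs_le_iff\<close>, smt (verit) K(2))
    qed (auto intro: indep_increments)
    have "?A n = {x \<in> space Pr. (\<Sum>i<n. f (x i)) \<le> (\<Sum>i<n. expectation (\<lambda>x. f (x i))) - n * m}"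
    proof (rule Collect_cong, rule conj_cong[OF refl])
      fix x assume x: "x \<in> space Pr"
      have "(\<Sum>i<n. expectation (\<lambda>x. f (x i))) = n * m" by (simp only: mean sum_constant card_lessThan)
      moreover have "(\<Sum>i<n. f (x i)) = real_of_int (s * Phi (walk x n))"
        unfolding f_def by (rule sum_Phi[OF x])
      ultimately show "s * Phi (walk x n) \<le> 0 \<longleftrightarrow>
          (\<Sum>i<n. f (x i)) \<le> (\<Sum>i<n. expectation (\<lambda>x. f (x i))) - n * m"
        by (simp only: diff_self of_int_le_0_iff)
    qed
    also have "prob \<dots> \<le> exp (-2 * (n * m)\<^sup>2 / (\<Sum>i<n. (K - - K)\<^sup>2))"
      using pos K False by (intro H.Hoeffding_ineq_le) (auto simp: m_def)
    also have "-2 * (n * m)\<^sup>2 / (\<Sum>i<n. (K - - K)\<^sup>2) = real n * (- (m\<^sup>2 / (2 * K\<^sup>2)))"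
      using False K by (simp add: field_simps power2_eq_square)
    also have "exp \<dots> = c ^ n" by (simp only: c_def exp_of_nat_mult)
    finally show ?thesis .
  qed simp
  have "summable (\<lambda>n. prob (?A n))"
    using bound c by (intro summable_comparison_test[OF _ summable_geometric[of c]]) auto
  then have "AE x in Pr. \<forall>\<^sub>F n in sequentially. x \<in> space Pr - ?A n"
    by (intro borel_cantelli_AE1 sets_walk) (simp_all add: emeasure_eq_measure)
  then show ?thesis by (rule AE_mp) (auto elim: eventually_mono simp: not_le)
qed

lemma Phi_nonconstant: "\<not> (\<forall>g\<in>set_pmf \<mu>. real_of_int (Phi g) = c)"
proof
  assume c: "\<forall>g\<in>set_pmf \<mu>. real_of_int (Phi g) = c"
  have mult: "\<exists>k\<ge>1::nat. real_of_int (Phi g) = k * c"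
    if "g \<in> semigroup_generated (Aff q) (set_pmf \<mu>)" for g
    using that
  proof induction
    case (generator g)
    then show ?case using c by (auto intro!: exI[of _ 1])
  next
    case (product g h)
    then obtain k l :: nat where "k \<ge> 1" "real_of_int (Phi g) = k * c" "real_of_int (Phi h) = l * c" by auto
    moreover have "g \<in> AffT" "h \<in> AffT"
      using product nondegenerate DA_Aff by (auto simp: nondegenerate_def)
    ultimately show ?case
      by (intro exI[of _ "k + l"]) (simp add: Phi_comp[OF q_pos] algebra_simps del: o_apply)
  qed
  have "c = 0" using mult[of id] id_DA nondegenerate by (auto simp: nondegenerate_def)
  then show False using mult[of "tree_shift q"] shift_DA nondegenerate Phi_shift
    by (auto simp: nondegenerate_def)
qed

lemma prob_height_low:
  fixes s :: int
  assumes s: "\<bar>s\<bar> = 1" and nonpos: "s * mean_height \<le> 0"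
  obtains \<delta> where "\<delta> > 0" "\<And>h::int. \<exists>n. prob {x \<in> space Pr. s * Phi (walk x n) \<le> - h} \<ge> \<delta>"
proof -
  define f where "f g = real_of_int (s * Phi g)" for g
  define m where "m = s * mean_height"
  define v where "v = (\<Sum>g\<in>set_pmf \<mu>. pmf \<mu> g * (f g - m)\<^sup>2)"
  have mean: "expectation (\<lambda>x. f (x i)) = m" for i
    by (subst expectation_coordinate) (simp add: m_def f_def mean_height_def sum_distrib_left ac_simps)
  have var: "variance (\<lambda>x. f (x i)) = v" for i
    unfolding mean v_def by (rule expectation_coordinate)
  have meas: "(\<lambda>x. f (x i)) \<in> borel_measurable Pr" for i
    by (rule measurable_compose[OF measurable_coordinate]) simp
  have "v > 0"
  proof -
    obtain g where g: "g \<in> set_pmf \<mu>" "real_of_int (Phi g) \<noteq> s * m" using Phi_nonconstant by blast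
    then have "f g \<noteq> m" using s by (auto simp: f_def abs_if split: if_splits)
    then have "0 < pmf \<mu> g * (f g - m)\<^sup>2" using g by (auto simp: pmf_positive_iff)
    then show ?thesis unfolding v_def
      by (intro sum_pos2[OF finite_support g(1)]) auto
  qed
  define \<sigma> where "\<sigma> = sqrt v"
  have \<sigma>: "\<sigma> > 0" "\<sigma>\<^sup>2 = v" using \<open>v > 0\<close> by (auto simp: \<sigma>_def)
  let ?Z = "\<lambda>(n::nat) x. (\<Sum>i<n. f (x i) - m) / sqrt (real n * \<sigma>\<^sup>2)"
  have "weak_conv_m (\<lambda>n. distr Pr borel (?Z n)) std_normal_distribution"
  proof (rule central_limit_theorem[where X = "\<lambda>i x. f (x i)" and \<mu> = "distr step_law borel f"])
    show "indep_vars (\<lambda>_. borel) (\<lambda>i x. f (x i)) UNIV" by (rule indep_increments)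
    show "variance (\<lambda>x. f (x n)) = \<sigma>\<^sup>2" for n using var \<sigma> by simp
    show "integrable Pr (\<lambda>x. (f (x n))\<^sup>2)" for n
    proof (rule integrable_const_bound)
      show "AE x in Pr. norm ((f (x n))\<^sup>2) \<le> (\<Sum>g\<in>set_pmf \<mu>. (f g)\<^sup>2)"
        using AE_coordinate[of n]
        by eventually_elim (auto intro!: member_le_sum finite_support)
    qed (use meas in measurable)
    show "distr Pr borel (\<lambda>x. f (x n)) = distr step_law borel f" for n
    proof -
      have "f \<in> borel_measurable step_law" "(\<lambda>x. x n) \<in> Pr \<rightarrow>\<^sub>M step_law"
        unfolding measurable_cong_sets[OF sets_step_law refl] measurable_cong_sets[OF refl sets_step_law]
        by (simp, rule measurable_coordinate)
      then have "distr (distr Pr step_law (\<lambda>x. x n)) borel f = distr Pr borel (f \<circ> (\<lambda>x. x n))"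
        by (rule distr_distr)
      then show ?thesis by (simp add: distr_coordinate comp_def)
    qed
  qed (use mean \<sigma> in auto)
  then have lim: "(\<lambda>n. cdf (distr Pr borel (?Z n)) (- 1)) \<longlonglongrightarrow> cdf std_normal_distribution (- 1)"
    using std_normal_cdf_isCont by (simp add: weak_conv_m_def weak_conv_def)
  define \<delta> where "\<delta> = cdf std_normal_distribution (- 1) / 2"
  have \<delta>: "\<delta> > 0" using std_normal_cdf_pos[of "- 1"] by (simp add: \<delta>_def)
  have ev: "\<forall>\<^sub>F n in sequentially. cdf (distr Pr borel (?Z n)) (- 1) > \<delta>"
    using lim by (rule order_tendstoD) (use std_normal_cdf_pos[of "- 1"] in \<open>simp add: \<delta>_def\<close>)
  have "\<exists>n. prob {x \<in> space Pr. s * Phi (walk x n) \<le> - h} \<ge> \<delta>" for h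
  proof -
    have "filterlim (\<lambda>n. sqrt (real n * \<sigma>\<^sup>2)) at_top sequentially"
      using \<sigma>(1)
      by (intro filterlim_compose[OF sqrt_at_top] filterlim_at_top_mult_tendsto_pos[OF tendsto_const]
          filterlim_real_sequentially) simp
    then have ev': "\<forall>\<^sub>F n in sequentially. sqrt (real n * \<sigma>\<^sup>2) \<ge> real_of_int \<bar>h\<bar> + 1"
      by (simp add: filterlim_at_top)
    obtain n where n: "cdf (distr Pr borel (?Z n)) (- 1) > \<delta>"
        "sqrt (real n * \<sigma>\<^sup>2) \<ge> real_of_int \<bar>h\<bar> + 1"
      using eventually_happens'[OF sequentially_bot eventually_conj[OF ev ev']] by blast
    have "cdf (distr Pr borel (?Z n)) (- 1) = prob {x \<in> space Pr. ?Z n x \<le> - 1}"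
      unfolding cdf_def using meas by (subst measure_distr) (auto intro!: arg_cong[where f = prob])
    also have "\<dots> \<le> prob {x \<in> space Pr. s * Phi (walk x n) \<le> - h}"
    proof (intro finite_measure_mono sets_walk subsetI)
      fix x assume x: "x \<in> {x \<in> space Pr. ?Z n x \<le> - 1}"
      have "(\<Sum>i<n. f (x i)) - n * m \<le> - sqrt (real n * \<sigma>\<^sup>2)"
      proof -
        have "sqrt (real n * \<sigma>\<^sup>2) > 0" using n(2) by linarith
        from pos_divide_le_eq[OF this] show ?thesis using x by (simp add: sum_subtractf)
      qed
      moreover have "real n * m \<le> 0" using nonpos by (simp add: m_def mult_nonneg_nonpos)
      moreover have "(\<Sum>i<n. f (x i)) = s * Phi (walk x n)"
        unfolding f_def by (rule sum_Phi) (use x in simp)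
      ultimately have "real_of_int (s * Phi (walk x n)) \<le> real_of_int (- h)" using n(2) by simp
      then show "x \<in> {x \<in> space Pr. s * Phi (walk x n) \<le> - h}" using x by (simp only: of_int_le_iff mem_Collect_eq simp_thms)
    qed
    finally show ?thesis using n(1) by (auto intro!: exI[of _ n])
  qed
  then show ?thesis using that \<delta> by blast
qed

end

section \<open>Triviality of the final configuration at large heights\<close>

context regular_tree
begin

definition eventually_trivial_configs :: "int \<Rightarrow> (vertex \<Rightarrow> nat \<Rightarrow> nat) set" where
  "eventually_trivial_configs s = {\<gamma> \<in> space (config_space q). eventually_trivial s \<gamma>}"

lemma sets_trivial_beyond: "{\<gamma> \<in> space (config_space q). trivial_beyond s h \<gamma>} \<in> sets (config_space q)"
proof -
  have "Measurable.pred (config_space q) (\<lambda>\<gamma>. \<gamma> v = id)" if "v \<in> V" for v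
  proof -
    have "(\<lambda>\<gamma>. \<gamma> v) \<in> config_space q \<rightarrow>\<^sub>M count_space (Sym q)"
      unfolding config_space_def using that by (rule measurable_component_singleton)
    from measurable_compose[OF this, of "\<lambda>\<sigma>. \<sigma> = id"] show ?thesis by simp
  qed
  then have "Measurable.pred (config_space q) (\<lambda>\<gamma>. h \<le> s * height v \<longrightarrow> \<gamma> v = id)" if "v \<in> V" for v
    using that by (cases "h \<le> s * height v") simp_all
  then have "{\<gamma> \<in> space (config_space q). h \<le> s * height v \<longrightarrow> \<gamma> v = id} \<in> sets (config_space q)"
    if "v \<in> V" for v
    using that by (intro predE)
  then have "(\<Inter>v\<in>V. {\<gamma> \<in> space (config_space q). h \<le> s * height v \<longrightarrow> \<gamma> v = id})
      \<in> sets (config_space q)"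
    using omega_verts[OF q_pos] by (intro sets.countable_INT' countable_verts) auto
  also have "(\<Inter>v\<in>V. {\<gamma> \<in> space (config_space q). h \<le> s * height v \<longrightarrow> \<gamma> v = id}) =
      {\<gamma> \<in> space (config_space q). trivial_beyond s h \<gamma>}"
    using omega_verts[OF q_pos] by (auto simp: trivial_beyond_def simp del: split_paired_All)
  finally show ?thesis .
qed

lemma sets_eventually_trivial_configs: "eventually_trivial_configs s \<in> sets (config_space q)"
proof -
  have "eventually_trivial_configs s =
      (\<Union>h. {\<gamma> \<in> space (config_space q). trivial_beyond s h \<gamma>})"
    by (auto simp: eventually_trivial_configs_def eventually_trivial_def)
  then show ?thesis using sets_trivial_beyond by auto
qed

end

context tree_walk
begin

lemma AE_eventually_trivial:
  fixes s :: int
  assumes pos: "s * mean_height > 0"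
  shows "AE x in Pr. eventually_trivial s (final_config q x)"
proof -
  let ?B = "\<Union>g\<in>set_pmf \<mu>. {v \<in> V. portrait q g v \<noteq> id}"
  have "bdd_above ((\<lambda>v. s * height v) ` ?B)"
    by (intro bdd_above_finite finite_imageI finite_support_portraits)
  then obtain K where "\<And>y. y \<in> (\<lambda>v. s * height v) ` ?B \<Longrightarrow> y \<le> K" by (meson bdd_above.E)
  then have K: "s * height v \<le> K" if "v \<in> ?B" for v using that by blast
  have "AE x in Pr. \<forall>i. x i \<in> set_pmf \<mu>"
    unfolding AE_all_countable using AE_coordinate by blast
  moreover have "AE x in Pr. \<forall>\<^sub>F n in sequentially. s * Phi (walk x n) > 0"
    by (rule AE_eventually_height_pos[OF pos])
  moreover have "AE x in Pr. x \<in> space Pr" by simp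
  ultimately show ?thesis
  proof eventually_elim
    case (elim x)
    have x: "range x \<subseteq> DA q" using elim by (simp add: space_Pr)
    obtain N where N: "\<And>n. n \<ge> N \<Longrightarrow> s * Phi (walk x n) > 0"
      using elim(2) by (auto simp: eventually_sequentially)
    define L where "L = Min (insert 0 ((\<lambda>n. s * Phi (walk x n)) ` {..N}))"
    have L: "L \<le> s * Phi (walk x n)" for n
    proof (cases "n \<le> N")
      case False
      have "L \<le> 0" by (simp add: L_def)
      then show ?thesis using N[of n] False by simp
    next
      case True
      then show ?thesis unfolding L_def by (intro Min_le) auto
    qed
    have "trivial_beyond s (K + 1 - L) (final_config q x)"
      unfolding trivial_beyond_def
    proof (intro ballI impI)
      fix v assume v: "v \<in> V" "K + 1 - L \<le> s * height v"
      have "portrait q (x n) (walk x n v) = id" for n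
      proof (rule ccontr)
        have A: "walk x n \<in> AffT" using walk_DA[OF x] DA_Aff by blast
        assume "portrait q (x n) (walk x n v) \<noteq> id"
        then have "walk x n v \<in> ?B" using elim(1) v A by auto
        then have "s * height (walk x n v) \<le> K" by (rule K)
        then have "s * height v + s * Phi (walk x n) \<le> K"
          using Aff_height[OF q_pos A v(1)] by (simp add: height_def algebra_simps)
        then show False using L[of n] v(2) by simp
      qed
      then have "limit_portrait x v id" by (rule limit_portrait_id[OF x v(1)])
      then show "final_config q x v = id" by (rule final_config_eqI[OF v(1)])
    qed
    then show ?case by (auto simp: eventually_trivial_def)
  qed
qed

lemma swap_fixes: "swap p t p = p"
  by (simp add: swap_def)

lemma sets_trivial_beyond_final:
  "{x \<in> space Pr. trivial_beyond s h (final_config q x)} \<in> sets Pr"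
proof -
  have "{x \<in> space Pr. trivial_beyond s h (final_config q x)} =
      final_config q -` {\<gamma> \<in> space (config_space q). trivial_beyond s h \<gamma>} \<inter> space Pr"
    using measurable_space[OF measurable_final_config] by auto
  then show ?thesis using measurable_sets[OF measurable_final_config sets_trivial_beyond] by simp
qed

lemma prob_eventually_trivial_0:
  fixes s :: int
  assumes s: "\<bar>s\<bar> = 1" and nonpos: "s * mean_height \<le> 0"
  shows "prob {x \<in> space Pr. eventually_trivial s (final_config q x)} = 0"
proof (rule ccontr)
  let ?o = "omega 0"
  define E where "E = {x \<in> space Pr. eventually_trivial s (final_config q x)}"
  define Eh where "Eh h = {x \<in> space Pr. trivial_beyond s h (final_config q x)}" for h
  define A where "A \<tau> = {x \<in> E. limit_portrait x ?o \<tau>}" for \<tau>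
  define p where "p = prob E"
  assume "prob {x \<in> space Pr. eventually_trivial s (final_config q x)} \<noteq> 0"
  then have p: "p > 0" by (simp add: p_def E_def zero_less_measure_iff)
  have o: "?o \<in> V" by (rule omega_verts[OF q_pos])
  have Eh: "Eh h \<in> sets Pr" for h unfolding Eh_def by (rule sets_trivial_beyond_final)
  have E_Union: "E = (\<Union>k::nat. Eh (int k))"
  proof
    show "E \<subseteq> (\<Union>k::nat. Eh (int k))"
    proof
      fix x assume "x \<in> E"
      then obtain h where "x \<in> space Pr" "trivial_beyond s h (final_config q x)"
        by (auto simp: E_def eventually_trivial_def)
      then have "x \<in> Eh (int (nat h))" by (auto simp: Eh_def trivial_beyond_def)
      then show "x \<in> (\<Union>k::nat. Eh (int k))" by blast
    qed
  qed (auto simp: E_def Eh_def eventually_trivial_def)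
  have E: "E \<in> sets Pr" unfolding E_Union using Eh by auto
  have A: "A \<tau> \<in> sets Pr" for \<tau>
  proof -
    have "A \<tau> = E \<inter> {x \<in> space Pr. limit_portrait x ?o \<tau>}" by (auto simp: A_def E_def)
    then show ?thesis using E predE[OF measurable_limit_portrait[OF o]] by auto
  qed
  have A_disj: "A \<tau> \<inter> A \<tau>' = {}" if "\<tau> \<noteq> \<tau>'" for \<tau> \<tau>'
  proof (rule equals0I)
    fix x assume "x \<in> A \<tau> \<inter> A \<tau>'"
    then have "limit_portrait x ?o \<tau>" "limit_portrait x ?o \<tau>'" by (simp_all add: A_def)
    then show False using that limit_portrait_unique by blast
  qed
  have E_shift: "x \<in> E \<longleftrightarrow> shift_seq n x \<in> E" if "x \<in> space Pr" for x n
    using that eventually_trivial_shift[OF Pr_step_DA[OF that] s, of n]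
      measurable_space[OF measurable_shift_seq that, of n] by (simp add: E_def)
  \<comment> \<open>No limiting portrait at \<open>o\<close> can absorb all the mass of \<open>E\<close>, since \<open>E\<close> is invariant
    under prepending an increment that only alters the portrait at \<open>o\<close>.\<close>
  obtain \<tau> where \<tau>: "\<tau> \<in> Sym q" "prob (A \<tau>) > 0"
  proof (rule ccontr)
    assume "\<not> thesis"
    then have "prob (A \<tau>) = 0" if "\<tau> \<in> Sym q" for \<tau>
      using that \<open>\<And>\<tau>. \<tau> \<in> Sym q \<Longrightarrow> 0 < prob (A \<tau>) \<Longrightarrow> thesis\<close> zero_less_measure_iff by blast
    moreover have "AE x in Pr. x \<in> E \<longrightarrow> x \<in> (\<Union>\<tau>\<in>Sym q. A \<tau>)"
      using AE_limit_portrait[OF o] by eventually_elim (auto simp: A_def)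
    then have "p \<le> prob (\<Union>\<tau>\<in>Sym q. A \<tau>)"
      unfolding p_def using A finite_Sym by (intro finite_measure_mono_AE) auto
    moreover have "prob (\<Union>\<tau>\<in>Sym q. A \<tau>) \<le> (\<Sum>\<tau>\<in>Sym q. prob (A \<tau>))"
      using A finite_Sym by (intro finite_measure_subadditive_finite) auto
    ultimately show False using p by simp
  qed
  define \<pi> where "\<pi> = Transposition.transpose 0 (1::nat)"
  have q1: "1 < q" using q_ge_2 by simp
  obtain n where n: "prob {x \<in> space Pr. walk x n = swap ?o 1} > 0"
    using walk_reaches[OF swap_DA[OF o q1]] .
  have "0 < prob {x \<in> space Pr. walk x n = swap ?o 1} * prob (A \<tau>)" using n \<tau> by simp
  also have "\<dots> = prob {x \<in> space Pr. walk x n = swap ?o 1 \<and> shift_seq n x \<in> A \<tau>}"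
    by (rule walk_independent[OF swap_DA[OF o q1] A, symmetric])
  also have "\<dots> \<le> prob (A (\<tau> \<circ> \<pi>))"
  proof (intro finite_measure_mono A subsetI)
    fix x assume x: "x \<in> {x \<in> space Pr. walk x n = swap ?o 1 \<and> shift_seq n x \<in> A \<tau>}"
    then have w: "walk x n = swap ?o 1" and r: "range x \<subseteq> DA q" by (auto simp: space_Pr)
    have "portrait q (walk x n) ?o = \<pi>" using portrait_swap[OF o q1 o] by (simp add: w \<pi>_def)
    then have "limit_portrait x ?o (\<tau> \<circ> \<pi>)"
      using limit_portrait_shift[OF r o, where n = n and \<sigma> = \<tau>] x by (simp add: w swap_fixes A_def)
    then show "x \<in> A (\<tau> \<circ> \<pi>)" using x E_shift[of x n] by (auto simp: A_def)
  qed
  finally have A\<pi>: "prob (A (\<tau> \<circ> \<pi>)) > 0" .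
  have "\<tau> 0 \<noteq> \<tau> 1" using \<tau>(1) permutes_inj[of \<tau> "{..<q}"] by (auto simp: Sym_def inj_eq)
  then have neq: "\<tau> \<noteq> \<tau> \<circ> \<pi>" by (auto simp: \<pi>_def dest: fun_cong[where x = 0])
  define \<epsilon> where "\<epsilon> = min (prob (A \<tau>)) (prob (A (\<tau> \<circ> \<pi>)))"
  have \<epsilon>: "\<epsilon> > 0" using \<tau> A\<pi> by (simp add: \<epsilon>_def)
  have A_le: "prob (A \<rho>) \<le> p - \<epsilon>" for \<rho>
  proof -
    have "prob (A \<rho>) + prob (A \<tau>') \<le> p" if "\<rho> \<noteq> \<tau>'" for \<tau>'
    proof -
      have "prob (A \<rho>) + prob (A \<tau>') = prob (A \<rho> \<union> A \<tau>')"
        by (rule finite_measure_Union[OF A A A_disj[OF that], symmetric])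
      also have "\<dots> \<le> p" unfolding p_def by (intro finite_measure_mono E) (auto simp: A_def)
      finally show ?thesis .
    qed
    from this[of \<tau>] this[of "\<tau> \<circ> \<pi>"] neq show ?thesis by (cases "\<rho> = \<tau>") (auto simp: \<epsilon>_def)
  qed
  obtain \<delta> where \<delta>: "\<delta> > 0" and low: "\<And>h::int. \<exists>n. prob {x \<in> space Pr. s * Phi (walk x n) \<le> - h} \<ge> \<delta>"
    using prob_height_low[OF s nonpos] by blast
  \<comment> \<open>If the walk is low at time \<open>n\<close>, triviality at the vertex that \<open>walk x n\<close> moves to \<open>o\<close>
    prescribes the limiting portrait of the future at \<open>o\<close>.\<close>
  have Eh_le: "prob (Eh h) \<le> p - \<epsilon> * \<delta>" for h
  proof -
    obtain n where n: "prob {x \<in> space Pr. s * Phi (walk x n) \<le> - h} \<ge> \<delta>" using low by blast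
    let ?G = "{x \<in> space Pr. s * Phi (walk x n) \<le> - h}"
    define Q where "Q g = (if s * Phi g \<le> - h
      then A (Hilbert_Choice.inv (portrait q g (Hilbert_Choice.inv g ?o))) else E)" for g
    have Q: "Q g \<in> sets Pr" for g using A E by (simp add: Q_def)
    have Q_le: "prob (Q g) \<le> p - \<epsilon> * of_bool (s * Phi g \<le> - h)" for g
      using A_le by (simp add: Q_def p_def)
    have "AE x in Pr. \<forall>v\<in>V. \<exists>\<sigma>\<in>Sym q. limit_portrait x v \<sigma>"
      using AE_limit_portrait by (simp add: AE_ball_countable[OF countable_verts])
    then have "AE x in Pr. x \<in> Eh h \<longrightarrow> x \<in> {x \<in> space Pr. shift_seq n x \<in> Q (walk x n)}"
    proof (eventually_elim, intro impI CollectI conjI)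
      fix x assume lim: "\<forall>v\<in>V. \<exists>\<sigma>\<in>Sym q. limit_portrait x v \<sigma>" and x: "x \<in> Eh h"
      then show xs: "x \<in> space Pr" by (simp add: Eh_def)
      note r = Pr_step_DA[OF xs]
      have "x \<in> E" using x by (auto simp: Eh_def E_def eventually_trivial_def)
      then have sE: "shift_seq n x \<in> E" using E_shift[OF xs] by blast
      define w where "w = walk x n"
      have w: "w \<in> AffT" using walk_DA[OF r] DA_Aff by (simp add: w_def)
      define v where "v = Hilbert_Choice.inv w ?o"
      have wv: "w v = ?o" using Aff_inverses[OF q_pos w] by (simp add: v_def)
      then have v: "v \<in> V" using o w by (metis Aff_verts_iff)
      have "shift_seq n x \<in> A (Hilbert_Choice.inv (portrait q w v))" if "s * Phi w \<le> - h"
      proof -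
        have "height v = - Phi w"
          using Aff_height[OF q_pos w v] by (simp add: height_def wv)
        then have "s * height v = - (s * Phi w)" by simp
        then have "final_config q x v = id" using x v that by (simp add: Eh_def trivial_beyond_def)
        then have "limit_portrait x v id" using lim v final_config_eqI[OF v, of x] by metis
        moreover have "Hilbert_Choice.inv (portrait q w v) \<circ> portrait q w v = id"
          using portrait_Sym[OF w v] permutes_inv_o(2) by (auto simp: Sym_def)
        ultimately have "limit_portrait (shift_seq n x) ?o (Hilbert_Choice.inv (portrait q w v))"
          using limit_portrait_shift[OF r v, where n = n and \<sigma> = "Hilbert_Choice.inv (portrait q w v)"]
          by (simp only: w_def[symmetric] wv)
        then show ?thesis using sE by (simp add: A_def)
      qed
      then show "shift_seq n x \<in> Q (walk x n)"
        using sE by (simp add: Q_def w_def[symmetric] v_def[symmetric])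
    qed
    then have "prob (Eh h) \<le> prob {x \<in> space Pr. shift_seq n x \<in> Q (walk x n)}"
      using measurable_split Q by (intro finite_measure_mono_AE) blast+
    also have "\<dots> = (\<integral>x. prob (Q (walk x n)) \<partial>Pr)" by (rule walk_split[OF Q])
    also have "\<dots> \<le> (\<integral>x. p - \<epsilon> * indicator ?G x \<partial>Pr)"
    proof (rule integral_mono)
      show "integrable Pr (\<lambda>x. prob (Q (walk x n)))"
        by (intro integrable_const_bound[where B = 1]
            measurable_compose[OF measurable_walk, of "\<lambda>g. prob (Q g)"]) auto
      show "integrable Pr (\<lambda>x. p - \<epsilon> * indicator ?G x)"
        by (intro Bochner_Integration.integrable_diff integrable_mult_right integrable_real_indicator sets_walk)
          (auto simp: emeasure_eq_measure)
      show "prob (Q (walk x n)) \<le> p - \<epsilon> * indicator ?G x" if "x \<in> space Pr" for x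
        using Q_le[of "walk x n"] that by (simp add: indicator_def of_bool_def)
    qed
    also have "\<dots> = p - \<epsilon> * prob ?G"
      using sets_walk[of "\<lambda>g. s * Phi g \<le> - h" n]
      by (subst Bochner_Integration.integral_diff) (auto simp: prob_space emeasure_eq_measure Int_absorb2 sets.sets_into_space)
    also have "\<dots> \<le> p - \<epsilon> * \<delta>" using n \<epsilon> by simp
    finally show ?thesis .
  qed
  have "incseq (\<lambda>k. Eh (int k))" by (auto simp: incseq_def Eh_def trivial_beyond_def)
  then have "(\<lambda>k. prob (Eh (int k))) \<longlonglongrightarrow> p"
    unfolding p_def E_Union using Eh by (intro finite_Lim_measure_incseq) auto
  then have "p \<le> p - \<epsilon> * \<delta>" by (rule LIMSEQ_le_const2) (use Eh_le in blast)
  then show False using \<epsilon> \<delta> by (simp add: mult_le_0_iff)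
qed

lemma emeasure_harmonic:
  assumes "S \<in> sets (config_space q)"
  shows "emeasure (harmonic_measure q \<mu>) S = prob {x \<in> space Pr. final_config q x \<in> S}"
  unfolding harmonic_measure_def
  by (subst emeasure_distr[OF measurable_final_config assms])
    (auto simp: emeasure_eq_measure intro!: arg_cong[where f = prob])

lemma AE_harmonic_eventually_trivial:
  fixes s :: int
  assumes "s * mean_height > 0"
  shows "AE \<gamma> in harmonic_measure q \<mu>. \<gamma> \<in> eventually_trivial_configs s"
  unfolding harmonic_measure_def
proof (subst AE_distr_iff[OF measurable_final_config])
  show "AE x in Pr. final_config q x \<in> eventually_trivial_configs s"
    using AE_eventually_trivial[OF assms] AE_space
    by eventually_elim
      (auto simp: eventually_trivial_configs_def dest: measurable_space[OF measurable_final_config])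
next
  have "{\<gamma> \<in> space (config_space q). \<gamma> \<in> eventually_trivial_configs s} = eventually_trivial_configs s"
    by (auto simp: eventually_trivial_configs_def)
  then show "{\<gamma> \<in> space (config_space q). \<gamma> \<in> eventually_trivial_configs s} \<in> sets (config_space q)"
    using sets_eventually_trivial_configs by simp
qed

lemma AE_harmonic_not_eventually_trivial:
  fixes s :: int
  assumes "\<bar>s\<bar> = 1" "s * mean_height \<le> 0"
  shows "AE \<gamma> in harmonic_measure q \<mu>. \<gamma> \<notin> eventually_trivial_configs s"
proof -
  have "{x \<in> space Pr. final_config q x \<in> eventually_trivial_configs s} =
      {x \<in> space Pr. eventually_trivial s (final_config q x)}"
    using measurable_space[OF measurable_final_config] by (auto simp: eventually_trivial_configs_def)
  then have "emeasure (harmonic_measure q \<mu>) (eventually_trivial_configs s) = 0"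
    using prob_eventually_trivial_0[OF assms]
    by (simp add: emeasure_harmonic sets_eventually_trivial_configs)
  then show ?thesis
    by (intro AE_not_in) (auto simp: null_sets_def harmonic_measure_def sets_eventually_trivial_configs)
qed

lemma sets_harmonic: "sets (harmonic_measure q \<mu>) = sets (config_space q)"
  and space_harmonic: "space (harmonic_measure q \<mu>) = space (config_space q)"
  by (simp_all add: harmonic_measure_def)

lemma prob_space_harmonic: "prob_space (harmonic_measure q \<mu>)"
  unfolding harmonic_measure_def by (rule prob_space_distr[OF measurable_final_config])

end

lemma mutually_singularI:
  assumes "prob_space M" "prob_space N" "sets M = sets N"
    and "A \<in> sets M" "B \<in> sets M" "A \<inter> B = {}" "emeasure M A = 1" "emeasure N B = 1"
  shows "mutually_singular M N"
proof -
  interpret M: prob_space M by fact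
  interpret N: prob_space N by fact
  have "AE x in M. x \<in> A" using assms M.prob_eq_1[of A] by (simp add: M.emeasure_eq_measure)
  then have "AE x in M. x \<notin> B" by eventually_elim (use assms in auto)
  then have "emeasure M B = 0" using assms by (simp add: AE_iff_measurable sets.sets_into_space Int_absorb2 null_sets_def AE_iff_null_sets[symmetric])
  moreover have "emeasure N (space N - B) = 0"
    using assms N.prob_compl[of B] by (simp add: N.emeasure_eq_measure)
  ultimately show ?thesis using assms unfolding mutually_singular_def by blast
qed

theorem proposition4p13:
  fixes q :: nat
    and \<mu>_neg \<mu>_zero \<mu>_pos :: "(vertex \<Rightarrow> vertex) pmf"
  assumes "q \<ge> 2"
    and "\<And>\<mu>. \<mu> \<in> {\<mu>_neg, \<mu>_zero, \<mu>_pos} \<Longrightarrow>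
           set_pmf \<mu> \<subseteq> DA q \<and> finite (set_pmf \<mu>) \<and> nondegenerate q \<mu> \<and> aperiodic q \<mu>"
    and "drift (reflected (Aff q) \<mu>_neg) < 0"
    and "drift (reflected (Aff q) \<mu>_zero) = 0"
    and "drift (reflected (Aff q) \<mu>_pos) > 0"
  shows "(\<exists>S_neg \<in> sets (config_space q). \<exists>S_zero \<in> sets (config_space q).
          \<exists>S_pos \<in> sets (config_space q).
            emeasure (harmonic_measure q \<mu>_neg) S_neg = 1 \<and>
            emeasure (harmonic_measure q \<mu>_zero) S_zero = 1 \<and>
            emeasure (harmonic_measure q \<mu>_pos) S_pos = 1 \<and>
            S_neg \<inter> S_zero = {} \<and> S_neg \<inter> S_pos = {} \<and> S_zero \<inter> S_pos = {}) \<and>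
         mutually_singular (harmonic_measure q \<mu>_neg) (harmonic_measure q \<mu>_zero) \<and>
         mutually_singular (harmonic_measure q \<mu>_neg) (harmonic_measure q \<mu>_pos) \<and>
         mutually_singular (harmonic_measure q \<mu>_zero) (harmonic_measure q \<mu>_pos)"
proof -
  interpret regular_tree q by unfold_locales fact
  have walk: "tree_walk q \<mu>" if "\<mu> \<in> {\<mu>_neg, \<mu>_zero, \<mu>_pos}" for \<mu>
    using assms(2)[OF that] by unfold_locales auto
  interpret N: tree_walk q \<mu>_neg by (rule walk) simp
  interpret Z: tree_walk q \<mu>_zero by (rule walk) simp
  interpret P: tree_walk q \<mu>_pos by (rule walk) simp
  define E where "E = eventually_trivial_configs"
  define S_neg where "S_neg = E 1 - E (- 1)"
  define S_pos where "S_pos = E (- 1) - E 1"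
  define S_zero where "S_zero = space (config_space q) - E 1 - E (- 1)"
  have mean: "N.mean_height > 0" "Z.mean_height = 0" "P.mean_height < 0"
    using assms(3-5) by (simp_all add: N.drift_reflected Z.drift_reflected P.drift_reflected)
  have sets: "S_neg \<in> sets (config_space q)" "S_zero \<in> sets (config_space q)"
      "S_pos \<in> sets (config_space q)"
    using sets_eventually_trivial_configs by (auto simp: S_neg_def S_zero_def S_pos_def E_def)
  have disj: "S_neg \<inter> S_zero = {}" "S_neg \<inter> S_pos = {}" "S_zero \<inter> S_pos = {}"
    by (auto simp: S_neg_def S_zero_def S_pos_def)
  note prob = N.prob_space_harmonic Z.prob_space_harmonic P.prob_space_harmonic
  have N: "emeasure (harmonic_measure q \<mu>_neg) S_neg = 1"
  proof (rule prob_space.emeasure_eq_1_AE[OF prob(1)])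
    show "AE \<gamma> in harmonic_measure q \<mu>_neg. \<gamma> \<in> S_neg"
      using N.AE_harmonic_eventually_trivial[of 1] N.AE_harmonic_not_eventually_trivial[of "- 1"] mean
      by (simp add: S_neg_def E_def)
  qed (use sets in \<open>simp add: N.sets_harmonic\<close>)
  have P: "emeasure (harmonic_measure q \<mu>_pos) S_pos = 1"
  proof (rule prob_space.emeasure_eq_1_AE[OF prob(3)])
    show "AE \<gamma> in harmonic_measure q \<mu>_pos. \<gamma> \<in> S_pos"
      using P.AE_harmonic_eventually_trivial[of "- 1"] P.AE_harmonic_not_eventually_trivial[of 1] mean
      by (simp add: S_pos_def E_def)
  qed (use sets in \<open>simp add: P.sets_harmonic\<close>)
  have Z: "emeasure (harmonic_measure q \<mu>_zero) S_zero = 1"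
  proof (rule prob_space.emeasure_eq_1_AE[OF prob(2)])
    show "AE \<gamma> in harmonic_measure q \<mu>_zero. \<gamma> \<in> S_zero"
      using Z.AE_harmonic_not_eventually_trivial[of "- 1"] Z.AE_harmonic_not_eventually_trivial[of 1] mean
      AE_space[of "harmonic_measure q \<mu>_zero"]
      by (simp add: S_zero_def E_def Z.space_harmonic)
  qed (use sets in \<open>simp add: Z.sets_harmonic\<close>)
  have sets_eq: "sets (harmonic_measure q \<mu>) = sets (config_space q)" for \<mu>
    by (simp add: harmonic_measure_def)
  have "mutually_singular (harmonic_measure q \<mu>_neg) (harmonic_measure q \<mu>_zero)"
    by (rule mutually_singularI[OF prob(1,2) _ _ _ disj(1) N Z]) (simp_all add: sets_eq sets)
  moreover have "mutually_singular (harmonic_measure q \<mu>_neg) (harmonic_measure q \<mu>_pos)"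
    by (rule mutually_singularI[OF prob(1,3) _ _ _ disj(2) N P]) (simp_all add: sets_eq sets)
  moreover have "mutually_singular (harmonic_measure q \<mu>_zero) (harmonic_measure q \<mu>_pos)"
    by (rule mutually_singularI[OF prob(2,3) _ _ _ disj(3) Z P]) (simp_all add: sets_eq sets)
  ultimately show ?thesis using sets disj N Z P by blast
qed

end
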